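(* Let $f(x)=\mathbb{E}_{\xi\sim D}f_\xi(x)$ on $\mathbb{R}^d$ and suppose that Assumptions (Smoothness), (Bounded variance) and (Bounded stochastic gradients) of the context hold, with constants $L$, $\sigma^2$, $G$. Let $f^*$ be the minimal value of $f$. Let $\{x_t\}$ be generated by the AdaSAM algorithm of the context with mini-batch size $b$, neighborhood size $\rho$, momentum parameters $\beta_1,\beta_2$, constant $\epsilon$, and a fixed base learning rate $\gamma>0$ satisfying $\gamma\le\frac{\epsilon}{16L}$. Then for every number of iterations $T\ge 1$, $$\frac1T\sum_{t=0}^{T-1}\mathbb{E}\|\nabla f(x_t)\|_2^2\;\le\;\frac{2G(f(x_0)-f^* )}{\gamma T}+\frac{8G\gamma L}{\epsilon}\,\frac{\sigma^2}{b\epsilon}+\Phi,$$ where $$\Phi=\frac{45GL^2\rho^2}{\epsilon}+\frac{2G^3}{(1-\beta_1)T}\,d\Big(\frac1\epsilon-\frac1G\Big)+\frac{6\gamma^2L^2\beta_1^2}{(1-\beta_1)^2}\,\frac{dG^3}{\epsilon^3}+\frac{2\big(4+(\frac{\beta_1}{1-\beta_1})^2\big)\gamma LG^3}{T}\,d\big(\epsilon^{-2}-G^{-2}\big)+\frac{8G\gamma L}{\epsilon}\,\frac{L\rho^2}{\epsilon}.$$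
   Context: Problem: minimize $f(x)=\mathbb{E}_{\xi\sim D}f_\xi(x)$ over $x\in\mathbb{R}^d$, where each $f_\xi:\mathbb{R}^d\to\mathbb{R}$ is differentiable and possibly non-convex (the finite sum $f=\frac1N\sum_{i=1}^N f_{\xi_i}$ is a special case). $\|\cdot\|$ is the Euclidean norm; $\odot$ is the entrywise (Hadamard) product; squares $[\cdot]^2$, square roots, reciprocals and maxima of vectors are entrywise. Assumptions. (Smoothness) For every $\xi$ and all $x,y$: $\|\nabla f_\xi(x)-\nabla f_\xi(y)\|\le L\|x-y\|$ and $\|\nabla f(x)-\nabla f(y)\|\le L\|x-y\|$, with $L>0$. (Bounded variance) For all $x$: $\mathbb{E}_{\xi}\nabla f_\xi(x)=\nabla f(x)$ and $\mathbb{E}_\xi\|\nabla f_\xi(x)-\nabla f(x)\|^2\le\sigma^2$; for a mini-batch $B$ of size $b$ and $f_B=\frac1b\sum_{\xi\in B}f_\xi$, $\mathbb{E}\|\nabla f_B(x)-\nabla f(x)\|^2\le\sigma^2/b$. (Bounded stochastic gradients) $\|\nabla f_\xi(x)\|_\infty\le G$ for all $\xi,x$. AdaSAM. Parameters: $\gamma>0$ (base learning rate), $\rho\ge0$ (neighborhood size), $\beta_1\in[0,1)$, $\beta_2\in[0,1]$, $\epsilon>0$ small, with $\epsilon\le G$. Deterministic initial point $x_0\in\mathbb{R}^d$; $m_{-1}=0$, $v_{-1}=0$, and $\hat v_{-1}$ is the vector with all entries $\epsilon^2$. For $t=0,1,2,\dots$: draw a fresh mini-batch $B_t$ of $b$ i.i.d.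 samples from $D$, independent of the past; set $s_t=\frac1b\sum_{\xi\in B_t}\nabla f_\xi(x_t)$; $\ \delta_t=\rho\, s_t/\|s_t\|$ (with $0/\|0\|:=0$); $\ g_t=\frac1b\sum_{\xi\in B_t}\nabla f_\xi(x_t+\delta_t)$ (same mini-batch); $\ m_t=\beta_1m_{t-1}+(1-\beta_1)g_t$; $\ v_t=\beta_2v_{t-1}+(1-\beta_2)[g_t]^2$; $\ \hat v_t=\max(\hat v_{t-1},v_t)$; $\ \eta_t=1/\sqrt{\hat v_t}$; $\ x_{t+1}=x_t-\gamma\, m_t\odot\eta_t$. $\mathbb{E}$ is expectation over all the randomness of the algorithm. *)

theory Defs
  imports "HOL-Probability.Probability"
begin

definition gradient :: "('v::real_inner \<Rightarrow> real) \<Rightarrow> 'v \<Rightarrow> 'v" where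
  "gradient h x = (THE g. GDERIV h x :> g)"

(* Meaningful only at points where h is differentiable; there it is the library's gradient. *)
lemma gradient_eqI:
  assumes "GDERIV h x :> g"
  shows "gradient h x = g"
  unfolding gradient_def
proof (rule the_equality)
  show "GDERIV h x :> g" by fact
next
  fix g' assume "GDERIV h x :> g'"
  then have "(\<lambda>y. y \<bullet> g') = (\<lambda>y. y \<bullet> g)"
    using assms unfolding gderiv_def by (rule has_derivative_unique)
  then have "\<forall>y. y \<bullet> g' = y \<bullet> g"
    by (blast dest: fun_cong)
  then show "g' = g"
    by (simp only: vector_eq_ldot)
qed

lemma gradient_gderiv:
  fixes h :: "'v::euclidean_space \<Rightarrow> real"
  assumes "h differentiable (at x)"
  shows "GDERIV h x :> gradient h x"
proof -
  obtain h' where h': "(h has_derivative h') (at x)"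
    using assms unfolding differentiable_def by blast
  then interpret h': linear h'
    by (rule has_derivative_linear)
  define g where "g = (\<Sum>i\<in>Basis. h' i *\<^sub>R i)"
  have "h' y = y \<bullet> g" for y
  proof -
    have "h' y = h' (\<Sum>i\<in>Basis. (y \<bullet> i) *\<^sub>R i)"
      by (simp add: euclidean_representation)
    also have "\<dots> = (\<Sum>i\<in>Basis. (y \<bullet> i) * h' i)"
      by (simp add: h'.sum h'.scale)
    also have "\<dots> = y \<bullet> g"
      unfolding g_def by (simp add: inner_sum_right mult.commute)
    finally show ?thesis .
  qed
  then have "h' = (\<lambda>y. y \<bullet> g)" by (intro ext)
  with h' have "GDERIV h x :> g"
    by (simp add: gderiv_def)
  then show ?thesis
    by (simp only: gradient_eqI)
qed

definition expected_loss :: "'a measure \<Rightarrow> ('a \<Rightarrow> 'v \<Rightarrow> real) \<Rightarrow> 'v \<Rightarrow> real" where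
  "expected_loss D f x = (\<integral>\<xi>. f \<xi> x \<partial>D)"

definition batch_grad ::
  "('a \<Rightarrow> 'v::real_inner \<Rightarrow> real) \<Rightarrow> nat \<Rightarrow> (nat \<Rightarrow> 'a) \<Rightarrow> 'v \<Rightarrow> 'v" where
  "batch_grad f b B x = (1 / real b) *\<^sub>R (\<Sum>i<b. gradient (f (B i)) x)"

definition smooth_losses :: "real \<Rightarrow> 'a measure \<Rightarrow> ('a \<Rightarrow> 'v::real_inner \<Rightarrow> real) \<Rightarrow> bool" where
  "smooth_losses L D f \<longleftrightarrow>
     (\<forall>\<xi>\<in>space D. \<forall>x y. norm (gradient (f \<xi>) x - gradient (f \<xi>) y) \<le> L * norm (x - y)) \<and>
     (\<forall>x y. norm (gradient (expected_loss D f) x - gradient (expected_loss D f) y)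
              \<le> L * norm (x - y))"

definition bounded_variance ::
  "real \<Rightarrow> 'a measure \<Rightarrow> ('a \<Rightarrow> 'v::euclidean_space \<Rightarrow> real) \<Rightarrow> bool" where
  "bounded_variance \<sigma> D f \<longleftrightarrow>
     (\<forall>x. (\<integral>\<xi>. gradient (f \<xi>) x \<partial>D) = gradient (expected_loss D f) x) \<and>
     (\<forall>x. (\<integral>\<xi>. (norm (gradient (f \<xi>) x - gradient (expected_loss D f) x))\<^sup>2 \<partial>D) \<le> \<sigma>\<^sup>2)"

definition bounded_batch_variance ::
  "real \<Rightarrow> 'w measure \<Rightarrow> 'a measure \<Rightarrow> ('a \<Rightarrow> 'v::euclidean_space \<Rightarrow> real) \<Rightarrow> nat
     \<Rightarrow> ('w \<Rightarrow> nat \<Rightarrow> 'a) \<Rightarrow> bool" where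
  "bounded_batch_variance \<sigma> M D f b B \<longleftrightarrow>
     (\<forall>x. (\<integral>\<omega>. (norm (batch_grad f b (B \<omega>) x - gradient (expected_loss D f) x))\<^sup>2 \<partial>M)
            \<le> \<sigma>\<^sup>2 / real b)"

definition bounded_gradients ::
  "real \<Rightarrow> 'a measure \<Rightarrow> ('a \<Rightarrow> 'v::euclidean_space \<Rightarrow> real) \<Rightarrow> bool" where
  "bounded_gradients G D f \<longleftrightarrow> (\<forall>\<xi>\<in>space D. \<forall>x. infnorm (gradient (f \<xi>) x) \<le> G)"

(* Division by zero yields 0, so the perturbation vanishes when the batch gradient does. *)
definition sam_grad ::
  "real \<Rightarrow> ('a \<Rightarrow> 'v::real_inner \<Rightarrow> real) \<Rightarrow> nat \<Rightarrow> (nat \<Rightarrow> 'a) \<Rightarrow> 'v \<Rightarrow> 'v" where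
  "sam_grad \<rho> f b B x =
     (let s = batch_grad f b B x; \<delta> = (\<rho> / norm s) *\<^sub>R s in batch_grad f b B (x + \<delta>))"

(* The state at index t is the tuple (x_t, m_{t-1}, v_{t-1}, vhat_{t-1}) that enters iteration t;
   the argument B t is the mini-batch of iteration t.
   Multiplication and powers on the vector type are entrywise. *)
primrec adasam_state ::
  "real \<Rightarrow> real \<Rightarrow> real \<Rightarrow> real \<Rightarrow> real \<Rightarrow> ('a \<Rightarrow> real ^ 'n \<Rightarrow> real) \<Rightarrow> nat \<Rightarrow> real ^ 'n
     \<Rightarrow> (nat \<Rightarrow> nat \<Rightarrow> 'a) \<Rightarrow> nat
     \<Rightarrow> (real ^ 'n) \<times> (real ^ 'n) \<times> (real ^ 'n) \<times> (real ^ 'n)" where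
  "adasam_state \<gamma> \<rho> \<beta>1 \<beta>2 \<epsilon> f b x0 B 0 = (x0, 0, 0, (\<chi> i. \<epsilon>\<^sup>2))"
| "adasam_state \<gamma> \<rho> \<beta>1 \<beta>2 \<epsilon> f b x0 B (Suc t) =
     (case adasam_state \<gamma> \<rho> \<beta>1 \<beta>2 \<epsilon> f b x0 B t of (x, m, v, vhat) \<Rightarrow>
        let g = sam_grad \<rho> f b (B t) x;
            m' = \<beta>1 *\<^sub>R m + (1 - \<beta>1) *\<^sub>R g;
            v' = \<beta>2 *\<^sub>R v + (1 - \<beta>2) *\<^sub>R g\<^sup>2;
            vhat' = (\<chi> i. max (vhat $ i) (v' $ i));
            \<eta> = (\<chi> i. 1 / sqrt (vhat' $ i))
        in (x - \<gamma> *\<^sub>R (m' * \<eta>), m', v', vhat'))"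

definition adasam_iterate ::
  "real \<Rightarrow> real \<Rightarrow> real \<Rightarrow> real \<Rightarrow> real \<Rightarrow> ('a \<Rightarrow> real ^ 'n \<Rightarrow> real) \<Rightarrow> nat \<Rightarrow> real ^ 'n
     \<Rightarrow> (nat \<Rightarrow> nat \<Rightarrow> 'a) \<Rightarrow> nat \<Rightarrow> real ^ 'n" where
  "adasam_iterate \<gamma> \<rho> \<beta>1 \<beta>2 \<epsilon> f b x0 B t = fst (adasam_state \<gamma> \<rho> \<beta>1 \<beta>2 \<epsilon> f b x0 B t)"

(* The samples indexed by (t, i), for iteration t and batch position i < b, are jointly
   independent with law D; joint independence over all t makes each batch independent of the past. *)
definition iid_batches ::
  "'w measure \<Rightarrow> 'a measure \<Rightarrow> nat \<Rightarrow> ('w \<Rightarrow> nat \<Rightarrow> nat \<Rightarrow> 'a) \<Rightarrow> bool" where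
  "iid_batches M D b B \<longleftrightarrow>
     prob_space.indep_vars M (\<lambda>_. D) (\<lambda>(t, i) \<omega>. B \<omega> t i) (UNIV \<times> {..<b}) \<and>
     (\<forall>t. \<forall>i<b. distr M D (\<lambda>\<omega>. B \<omega> t i) = D)"

end

theory Submission
  imports Defs
begin

text \<open>
  With \<open>\<kappa> = \<beta>1 / (1 - \<beta>1)\<close>, the shifted iterate \<open>z\<^sub>t = x\<^sub>t + \<kappa> (x\<^sub>t - x\<^sub>t\<^sub>-\<^sub>1)\<close> absorbs the momentum:
  \<open>z\<^sub>t\<^sub>+\<^sub>1 - z\<^sub>t = - \<gamma> g\<^sub>t \<eta>\<^sub>t + \<gamma> \<kappa> m\<^sub>t\<^sub>-\<^sub>1 (\<eta>\<^sub>t\<^sub>-\<^sub>1 - \<eta>\<^sub>t)\<close>. The descent inequality for the expected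
  loss is applied to \<open>z\<close>. Since the step sizes \<open>\<eta>\<^sub>t\<close> are entrywise nonincreasing with values in
  \<open>[1/G, 1/\<epsilon>]\<close>, replacing \<open>\<eta>\<^sub>t\<close> by \<open>\<eta>\<^sub>t\<^sub>-\<^sub>1\<close> costs only telescoping terms in \<open>\<eta>\<close> and \<open>\<eta>\<^sup>2\<close>,
  which are added to the loss to form a potential.
  Splitting \<open>g\<^sub>t = \<nabla>F(x\<^sub>t) + (s\<^sub>t - \<nabla>F(x\<^sub>t)) + (g\<^sub>t - s\<^sub>t)\<close>, the last part has norm at most \<open>L \<rho>\<close>,
  and the middle part is multiplied only by quantities that depend on earlier batches. So the
  per-step estimate holds for every outcome, and the expectation is taken only after summing, where
  independence removes the linear noise term and bounds the quadratic one by the batch variance.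
\<close>

section \<open>Smoothness, measurability and independence\<close>

lemma GDERIV_imp_DERIV_line:
  fixes h :: "'v::real_inner \<Rightarrow> real"
  assumes "GDERIV h (x + s *\<^sub>R v) :> g"
  shows "((\<lambda>s. h (x + s *\<^sub>R v)) has_real_derivative v \<bullet> g) (at s)"
proof -
  have "((\<lambda>s. h (x + s *\<^sub>R v)) has_derivative (\<lambda>t. (t *\<^sub>R v) \<bullet> g)) (at s)"
    using assms unfolding gderiv_def
    by (rule has_derivative_compose[rotated]) (auto intro!: derivative_eq_intros)
  then show ?thesis
    by (simp add: has_field_derivative_def mult_commute_abs)
qed

text \<open>The descent lemma. Along the segment from \<open>x\<close> to \<open>y\<close>,
  \<open>h\<close> minus its quadratic model is nonincreasing: Cauchy-Schwarz and the Lipschitz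
  bound make its derivative at \<open>s\<close> at most 0. Comparing \<open>s = 0\<close> with
  \<open>s = 1\<close> gives the claim.\<close>

lemma lipschitz_gradient_upper_bound:
  fixes h :: "'v::euclidean_space \<Rightarrow> real"
  assumes diff: "\<And>x. h differentiable (at x)"
    and lip: "\<And>x y. norm (gradient h x - gradient h y) \<le> L * norm (x - y)"
  shows "h y \<le> h x + gradient h x \<bullet> (y - x) + L / 2 * (norm (y - x))\<^sup>2"
proof -
  define v where "v = y - x"
  define \<phi> where "\<phi> s = h (x + s *\<^sub>R v) - s * (gradient h x \<bullet> v) - L / 2 * s\<^sup>2 * (norm v)\<^sup>2" for s
  have "\<phi> 1 \<le> \<phi> 0"
  proof (rule DERIV_nonpos_imp_nonincreasing[of 0 1 \<phi>])
    fix s :: real assume s: "0 \<le> s" "s \<le> 1"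
    let ?g = "gradient h (x + s *\<^sub>R v)"
    have "(\<phi> has_real_derivative v \<bullet> ?g - gradient h x \<bullet> v - L * s * (norm v)\<^sup>2) (at s)"
      unfolding \<phi>_def
      by (rule GDERIV_imp_DERIV_line gradient_gderiv diff derivative_eq_intros refl | simp)+
    moreover have "v \<bullet> (?g - gradient h x) \<le> norm v * (L * (s * norm v))"
      using norm_cauchy_schwarz[of v "?g - gradient h x"] lip[of "x + s *\<^sub>R v" x] s
      by (smt (verit, best) add_diff_cancel_left' mult_left_mono norm_ge_zero norm_scaleR)
    ultimately show "\<exists>d. (\<phi> has_real_derivative d) (at s) \<and> d \<le> 0"
      by (force simp: inner_diff_right inner_commute power2_eq_square algebra_simps)
  qed simp
  then show ?thesis
    by (simp add: \<phi>_def v_def)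
qed

text \<open>Approximate \<open>Y\<close> by measurable maps with values in a countable dense set.
  Each composite is measurable because it is glued from countably many measurable pieces, and
  continuity in the second argument gives the pointwise limit. This handles gradients whose sample
  and evaluation point are both random.\<close>

lemma borel_measurable_caratheodory:
  fixes g :: "'a \<Rightarrow> 'c::{metric_space, second_countable_topology} \<Rightarrow> 'b::metric_space"
  assumes meas: "\<And>x. (\<lambda>\<xi>. g \<xi> x) \<in> borel_measurable D"
    and cont: "\<And>\<xi>. \<xi> \<in> space D \<Longrightarrow> continuous_on UNIV (g \<xi>)"
    and X[measurable]: "X \<in> measurable N D" and Y[measurable]: "Y \<in> borel_measurable N"
  shows "(\<lambda>\<omega>. g (X \<omega>) (Y \<omega>)) \<in> borel_measurable N"
proof -
  obtain S :: "'c set" where S: "countable S" "\<And>U. open U \<Longrightarrow> U \<noteq> {} \<Longrightarrow> \<exists>d\<in>S. d \<in> U"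
    using countable_dense_exists by blast
  define e where "e = from_nat_into S"
  have "S \<noteq> {}" using S(2)[of UNIV] by auto
  have ex: "\<exists>n. dist (e n) y < 1 / Suc k" for y k
  proof -
    obtain d where "d \<in> S" "dist d y < 1 / Suc k"
      using S(2)[of "ball y (1 / Suc k)"] by (auto simp: dist_commute)
    then show ?thesis
      using from_nat_into_surj[OF S(1), of d] by (auto simp: e_def)
  qed
  \<comment> \<open>Taking the least admissible index makes the choice measurable in
    \<open>y\<close>.\<close>
  define q where "q k y = (LEAST n. dist (e n) y < 1 / Suc k)" for k y
  have q: "dist (e (q k y)) y < 1 / Suc k" for k y
    unfolding q_def using ex by (rule LeastI_ex)
  have [measurable]: "(\<lambda>\<omega>. q k (Y \<omega>)) \<in> measurable N (count_space UNIV)" for k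
    unfolding q_def by measurable
  have "(\<lambda>k. e (q k y)) \<longlonglongrightarrow> y" for y
  proof (rule metric_tendsto_imp_tendsto[where f = "\<lambda>k. 1 / real (Suc k)" and a = 0])
    show "(\<lambda>k. 1 / real (Suc k)) \<longlonglongrightarrow> 0"
      using LIMSEQ_inverse_real_of_nat by (simp add: inverse_eq_divide)
  qed (use q in \<open>auto intro!: always_eventually less_imp_le\<close>)
  show ?thesis
  proof (rule borel_measurable_LIMSEQ_metric[where f = "\<lambda>k \<omega>. g (X \<omega>) (e (q k (Y \<omega>)))"])
    fix k
    show "(\<lambda>\<omega>. g (X \<omega>) (e (q k (Y \<omega>)))) \<in> borel_measurable N"
      by (rule measurable_compose_countable[of "\<lambda>n \<omega>. g (X \<omega>) (e n)"])
        (auto intro: measurable_compose[OF X meas])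
  next
    fix \<omega> assume "\<omega> \<in> space N"
    then have "isCont (g (X \<omega>)) (Y \<omega>)"
      using cont measurable_space[OF X] by (simp add: continuous_on_eq_continuous_at)
    then show "(\<lambda>k. g (X \<omega>) (e (q k (Y \<omega>)))) \<longlonglongrightarrow> g (X \<omega>) (Y \<omega>)"
      using \<open>\<And>y. (\<lambda>k. e (q k y)) \<longlonglongrightarrow> y\<close> by (rule isCont_tendsto_compose)
  qed
qed

text \<open>Each component is the pointwise limit of difference quotients with step
  \<open>1 / (n + 1)\<close>, and these inherit measurability in the sample from the loss
  values.\<close>

lemma borel_measurable_gradient:
  fixes f :: "'a \<Rightarrow> 'v::euclidean_space \<Rightarrow> real"
  assumes meas: "\<And>x. (\<lambda>\<xi>. f \<xi> x) \<in> borel_measurable D"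
    and diff: "\<And>\<xi>. \<xi> \<in> space D \<Longrightarrow> f \<xi> differentiable (at x)"
  shows "(\<lambda>\<xi>. gradient (f \<xi>) x) \<in> borel_measurable D"
proof (rule borel_measurable_euclidean_space[THEN iffD2], rule ballI)
  fix i :: 'v
  show "(\<lambda>\<xi>. gradient (f \<xi>) x \<bullet> i) \<in> borel_measurable D"
  proof (rule borel_measurable_LIMSEQ_real)
    fix \<xi> assume "\<xi> \<in> space D"
    have "((\<lambda>s. f \<xi> (x + s *\<^sub>R i)) has_real_derivative i \<bullet> gradient (f \<xi>) x) (at 0)"
      using GDERIV_imp_DERIV_line[of "f \<xi>" x 0 i] gradient_gderiv[OF diff[OF \<open>\<xi> \<in> space D\<close>]] by simp
    then have "((\<lambda>h. (f \<xi> (x + h *\<^sub>R i) - f \<xi> x) / h) \<longlongrightarrow> gradient (f \<xi>) x \<bullet> i) (at 0)"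
      by (simp add: DERIV_def inner_commute)
    moreover have "filterlim (\<lambda>n. inverse (real (Suc n))) (at 0) sequentially"
      unfolding filterlim_at using LIMSEQ_inverse_real_of_nat by simp
    ultimately show "(\<lambda>n. (f \<xi> (x + inverse (real (Suc n)) *\<^sub>R i) - f \<xi> x) / inverse (real (Suc n)))
        \<longlonglongrightarrow> gradient (f \<xi>) x \<bullet> i"
      by (rule filterlim_compose)
  qed (use meas in measurable)
qed

text \<open>Stands in for conditioning on the past: by independence the joint law is a product, so
  Fubini allows \<open>X\<close> to be frozen at a point \<open>p\<close> while \<open>Y\<close> is
  averaged. A bound uniform in \<open>p\<close> survives the outer integral.\<close>

lemma (in prob_space) indep_var_expectation_le:
  fixes h :: "'b \<times> 'b \<Rightarrow> real"
  assumes ind: "indep_var S X N Y" and h[measurable]: "h \<in> borel_measurable (S \<Otimes>\<^sub>M N)"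
    and int: "integrable M (\<lambda>\<omega>. h (X \<omega>, Y \<omega>))"
    and le: "\<And>p. p \<in> space S \<Longrightarrow> expectation (\<lambda>\<omega>. h (p, Y \<omega>)) \<le> c"
  shows "expectation (\<lambda>\<omega>. h (X \<omega>, Y \<omega>)) \<le> c"
proof -
  have [measurable]: "X \<in> measurable M S" "Y \<in> measurable M N"
    and eq: "distr M S X \<Otimes>\<^sub>M distr M N Y = distr M (S \<Otimes>\<^sub>M N) (\<lambda>x. (X x, Y x))"
    using ind unfolding indep_var_distribution_eq by auto
  interpret X: prob_space "distr M S X" by (rule prob_space_distr) measurable
  interpret Y: prob_space "distr M N Y" by (rule prob_space_distr) measurable
  interpret XY: pair_prob_space "distr M S X" "distr M N Y" ..
  have I: "integrable (distr M S X \<Otimes>\<^sub>M distr M N Y) h"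
    unfolding eq using int by (simp add: integrable_distr_eq)
  have "expectation (\<lambda>\<omega>. h (X \<omega>, Y \<omega>)) = integral\<^sup>L (distr M S X \<Otimes>\<^sub>M distr M N Y) h"
    unfolding eq by (simp add: integral_distr)
  also have "\<dots> = (\<integral>p. (\<integral>y. h (p, y) \<partial>distr M N Y) \<partial>distr M S X)"
    using XY.integral_fst'[OF I] by simp
  also have "\<dots> \<le> c"
  proof (rule X.integral_le_const)
    show "integrable (distr M S X) (\<lambda>p. \<integral>y. h (p, y) \<partial>distr M N Y)"
      using XY.integrable_fst'[OF I] by simp
    show "AE p in distr M S X. (\<integral>y. h (p, y) \<partial>distr M N Y) \<le> c"
    proof (rule AE_I2)
      fix p assume "p \<in> space (distr M S X)"
      then have p: "p \<in> space S" by simp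
      then have [measurable]: "(\<lambda>y. h (p, y)) \<in> borel_measurable N" by simp
      show "(\<integral>y. h (p, y) \<partial>distr M N Y) \<le> c"
        using le[OF p] by (simp add: integral_distr)
    qed
  qed
  finally show ?thesis .
qed

section \<open>The estimate for a single step\<close>

text \<open>
  One coordinate of one step: \<open>Q\<close>, \<open>P\<close> are the gradients of the expected loss at \<open>x\<^sub>t\<close>, \<open>z\<^sub>t\<close>; \<open>n\<close> is the
  sampling error \<open>s\<^sub>t - \<nabla>F(x\<^sub>t)\<close>; \<open>e = g\<^sub>t - s\<^sub>t\<close>; \<open>\<eta>\<close>, \<open>\<eta>'\<close> are the new and the old step size;
  \<open>w = z\<^sub>t\<^sub>+\<^sub>1 - z\<^sub>t\<close>. The noise enters linearly only through \<open>\<eta>' * P * n\<close>, where \<open>\<eta>' * P\<close> is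
  determined by the past.
\<close>
lemma adaptive_step_coordinate_bound:
  fixes a n e Q m \<eta> \<eta>' \<gamma> \<kappa> L G \<epsilon> :: real
  defines "P \<equiv> Q + a" and "g \<equiv> Q + n + e"
  defines "w \<equiv> - \<gamma> * g * \<eta> + \<gamma> * \<kappa> * m * (\<eta>' - \<eta>)"
  assumes bd: "\<bar>P\<bar> \<le> G" "\<bar>g\<bar> \<le> G" "\<bar>m\<bar> \<le> G"
    and \<eta>: "1 / G \<le> \<eta>" "\<eta> \<le> \<eta>'" "\<eta>' \<le> 1 / \<epsilon>"
    and pos: "0 < \<epsilon>" "0 < G" "0 < \<gamma>" "0 \<le> \<kappa>" "0 < L" and step: "\<gamma> \<le> \<epsilon> / (16 * L)"
  shows "P * w + L / 2 * w\<^sup>2 \<le> - \<gamma> / (2 * G) * Q\<^sup>2 + 5 / 2 * \<gamma> / \<epsilon> * a\<^sup>2 + 43 / 16 * \<gamma> / \<epsilon> * e\<^sup>2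
    + \<gamma> * G\<^sup>2 * (1 + \<kappa>) * (\<eta>' - \<eta>) + L * \<gamma>\<^sup>2 * \<kappa>\<^sup>2 * G\<^sup>2 * (\<eta>'\<^sup>2 - \<eta>\<^sup>2)
    - \<gamma> * \<eta>' * P * n + 3 * L * \<gamma>\<^sup>2 / \<epsilon>\<^sup>2 * n\<^sup>2"
proof -
  have \<eta>0: "0 < \<eta>" "0 < \<eta>'" using \<eta> pos by (smt (verit) divide_pos_pos)+
  have Lg: "L * \<gamma> \<le> \<epsilon> / 16" using step pos by (simp add: field_simps)
  have \<eta>e: "\<eta>' * \<epsilon> \<le> 1" using \<eta> pos by (simp add: field_simps)
  have Pg: "P * g \<le> G\<^sup>2" "P * m \<le> G\<^sup>2" "m\<^sup>2 \<le> G\<^sup>2"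
    using mult_mono[OF bd(1) bd(2)] mult_mono[OF bd(1) bd(3)] bd(3) pos
    by (auto simp: abs_mult[symmetric] power2_eq_square abs_le_square_iff[symmetric] simp flip: power2_eq_square)
  \<comment> \<open>Naming these products lets the final combination treat them as atoms of a linear
    problem.\<close>
  define X A E where "X = \<gamma> * (\<eta>' * Q\<^sup>2)" and "A = \<gamma> * (\<eta>' * a\<^sup>2)" and "E = \<gamma> * (\<eta>' * e\<^sup>2)"
  note XAE = X_def A_def E_def
  \<comment> \<open>Writing \<open>\<eta> = \<eta>' - (\<eta>' - \<eta>)\<close> leaves only the old
    step size in front of \<open>P * g\<close>. The remainder is a multiple of the nonnegative
    difference \<open>\<eta>' - \<eta>\<close>, which telescopes over time.\<close>
  have "P * w = - \<gamma> * \<eta>' * (P * g) + \<gamma> * (\<eta>' - \<eta>) * (P * g) + \<gamma> * (\<eta>' - \<eta>) * \<kappa> * (P * m)"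
    by (simp add: w_def algebra_simps)
  also have "\<dots> \<le> - \<gamma> * \<eta>' * (P * g) + \<gamma> * (\<eta>' - \<eta>) * G\<^sup>2 + \<gamma> * (\<eta>' - \<eta>) * \<kappa> * G\<^sup>2"
    using Pg pos \<eta> by (intro add_mono mult_left_mono order_refl) auto
  finally have 1: "P * w \<le> - \<gamma> * \<eta>' * (P * g) + \<gamma> * G\<^sup>2 * (1 + \<kappa>) * (\<eta>' - \<eta>)"
    by (simp add: algebra_simps)
  \<comment> \<open>Young's inequality with weights that keep \<open>3 / 4\<close> of the square of
    \<open>Q\<close>: the quadratic term of the descent lemma will take another
    \<open>3 / 16\<close>, and at least \<open>1 / 2\<close> must remain.\<close>
  have Qae: "- ((Q + a) * (Q + e)) \<le> - 3 / 4 * Q\<^sup>2 + 5 / 2 * a\<^sup>2 + 5 / 2 * e\<^sup>2"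
  proof -
    have "0 \<le> (Q / 2 + 2 * a)\<^sup>2 / 2 + (Q / 2 + 2 * e)\<^sup>2 / 2 + (a + e)\<^sup>2 / 2"
      by simp
    then show ?thesis by (simp add: power2_eq_square field_simps)
  qed
  have "- (P * g) = - P * n - (Q + a) * (Q + e)"
    by (simp add: P_def g_def algebra_simps)
  with Qae have "(\<gamma> * \<eta>') * - (P * g) \<le> (\<gamma> * \<eta>') * (- P * n + (- 3 / 4 * Q\<^sup>2 + 5 / 2 * a\<^sup>2 + 5 / 2 * e\<^sup>2))"
    using pos \<eta>0 by (intro mult_left_mono) (linarith, simp)
  then have 2: "- \<gamma> * \<eta>' * (P * g) \<le> - (\<gamma> * \<eta>' * P * n) - 3 / 4 * X + 5 / 2 * A + 5 / 2 * E"
    by (simp add: XAE algebra_simps)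
  have "w\<^sup>2 \<le> 2 * (\<gamma> * g * \<eta>)\<^sup>2 + 2 * (\<gamma> * \<kappa> * m * (\<eta>' - \<eta>))\<^sup>2"
  proof -
    have "0 \<le> (\<gamma> * g * \<eta> + \<gamma> * \<kappa> * m * (\<eta>' - \<eta>))\<^sup>2" by simp
    then show ?thesis by (simp add: w_def power2_eq_square algebra_simps)
  qed
  also have "(\<gamma> * g * \<eta>)\<^sup>2 \<le> (\<gamma>\<^sup>2 * \<eta>'\<^sup>2) * (3 * Q\<^sup>2 + 3 * n\<^sup>2 + 3 * e\<^sup>2)"
  proof -
    have "0 \<le> (Q - n)\<^sup>2 + (Q - e)\<^sup>2 + (n - e)\<^sup>2" by simp
    then have "g\<^sup>2 \<le> 3 * Q\<^sup>2 + 3 * n\<^sup>2 + 3 * e\<^sup>2"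
      by (simp add: g_def power2_eq_square algebra_simps)
    moreover have "\<eta>\<^sup>2 \<le> \<eta>'\<^sup>2" using \<eta> \<eta>0 by (intro power_mono) auto
    ultimately have "(\<gamma>\<^sup>2 * \<eta>\<^sup>2) * g\<^sup>2 \<le> (\<gamma>\<^sup>2 * \<eta>'\<^sup>2) * (3 * Q\<^sup>2 + 3 * n\<^sup>2 + 3 * e\<^sup>2)"
      by (intro mult_mono) auto
    then show ?thesis by (simp only: power_mult_distrib ac_simps)
  qed
  also have "(\<gamma> * \<kappa> * m * (\<eta>' - \<eta>))\<^sup>2 \<le> (\<gamma>\<^sup>2 * \<kappa>\<^sup>2) * (G\<^sup>2 * (\<eta>'\<^sup>2 - \<eta>\<^sup>2))"
  proof -
    \<comment> \<open>For \<open>0 \<le> \<eta> \<le> \<eta>'\<close> the square of the difference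
      is at most the difference of the squares, which telescopes.\<close>
    have "0 \<le> 2 * \<eta> * (\<eta>' - \<eta>)" using \<eta> \<eta>0 by simp
    then have "(\<eta>' - \<eta>)\<^sup>2 \<le> \<eta>'\<^sup>2 - \<eta>\<^sup>2" by (simp add: power2_eq_square algebra_simps)
    then have "(\<gamma>\<^sup>2 * \<kappa>\<^sup>2) * (m\<^sup>2 * (\<eta>' - \<eta>)\<^sup>2) \<le> (\<gamma>\<^sup>2 * \<kappa>\<^sup>2) * (G\<^sup>2 * (\<eta>'\<^sup>2 - \<eta>\<^sup>2))"
      using Pg by (intro mult_left_mono mult_mono) auto
    then show ?thesis by (simp only: power_mult_distrib ac_simps)
  qed
  finally have "L / 2 * w\<^sup>2 \<le> L / 2 * (2 * ((\<gamma>\<^sup>2 * \<eta>'\<^sup>2) * (3 * Q\<^sup>2 + 3 * n\<^sup>2 + 3 * e\<^sup>2)) + 2 * ((\<gamma>\<^sup>2 * \<kappa>\<^sup>2) * (G\<^sup>2 * (\<eta>'\<^sup>2 - \<eta>\<^sup>2))))"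
    using pos by (intro mult_left_mono) auto
  then have 3: "L / 2 * w\<^sup>2 \<le> 3 * (L * \<gamma>\<^sup>2 * \<eta>'\<^sup>2) * (Q\<^sup>2 + e\<^sup>2) + 3 * L * \<gamma>\<^sup>2 * \<eta>'\<^sup>2 * n\<^sup>2 + L * \<gamma>\<^sup>2 * \<kappa>\<^sup>2 * G\<^sup>2 * (\<eta>'\<^sup>2 - \<eta>\<^sup>2)"
    by (simp add: algebra_simps)
  \<comment> \<open>The step size condition enters here:
    \<open>L * \<gamma> \<le> \<epsilon> / 16\<close> and
    \<open>\<eta>' \<le> 1 / \<epsilon>\<close> make the curvature term a sixteenth of the
    first-order one.\<close>
  have "L * \<gamma>\<^sup>2 * \<eta>'\<^sup>2 \<le> \<gamma> * \<eta>' / 16"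
  proof -
    have "(L * \<gamma>) * \<eta>' \<le> (\<epsilon> / 16) * \<eta>'" using Lg \<eta>0 by (intro mult_right_mono) auto
    also have "\<dots> \<le> 1 / 16" using \<eta>e by (simp add: algebra_simps)
    finally have "(\<gamma> * \<eta>') * ((L * \<gamma>) * \<eta>') \<le> (\<gamma> * \<eta>') * (1 / 16)"
      using pos \<eta>0 by (intro mult_left_mono) auto
    then show ?thesis by (simp add: power2_eq_square algebra_simps)
  qed
  from mult_left_mono[OF this, of "3 * (Q\<^sup>2 + e\<^sup>2)"]
  have 4: "3 * (L * \<gamma>\<^sup>2 * \<eta>'\<^sup>2) * (Q\<^sup>2 + e\<^sup>2) \<le> 3 / 16 * X + 3 / 16 * E"
    by (simp add: XAE algebra_simps)
  have "\<eta>'\<^sup>2 \<le> (1 / \<epsilon>)\<^sup>2" using \<eta> \<eta>0 by (intro power_mono) auto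
  then have "(3 * L * \<gamma>\<^sup>2 * n\<^sup>2) * \<eta>'\<^sup>2 \<le> (3 * L * \<gamma>\<^sup>2 * n\<^sup>2) * (1 / \<epsilon>)\<^sup>2"
    using pos by (intro mult_left_mono) auto
  then have 5: "3 * L * \<gamma>\<^sup>2 * \<eta>'\<^sup>2 * n\<^sup>2 \<le> 3 * L * \<gamma>\<^sup>2 / \<epsilon>\<^sup>2 * n\<^sup>2"
    by (simp add: power_divide algebra_simps)
  \<comment> \<open>\<open>9 / 16 = 3 / 4 - 3 / 16\<close> is what is left of the descent; it is
    rounded down to \<open>1 / 2\<close> and combined with \<open>\<eta>' \<ge> 1 / G\<close>.
    Likewise \<open>43 / 16 = 5 / 2 + 3 / 16\<close> collects the two costs of
    \<open>e\<close>.\<close>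
  have "(9 / 16 * \<gamma> * Q\<^sup>2) * \<eta>' \<ge> (1 / 2 * \<gamma> * Q\<^sup>2) * (1 / G)"
    using pos \<eta> by (intro mult_mono) (auto intro!: mult_right_mono)
  then have 6: "- 9 / 16 * X \<le> - \<gamma> / (2 * G) * Q\<^sup>2"
    by (simp add: XAE algebra_simps)
  have 7: "5 / 2 * A \<le> 5 / 2 * \<gamma> / \<epsilon> * a\<^sup>2"
    using mult_left_mono[OF \<eta>(3), of "5 / 2 * \<gamma> * a\<^sup>2"] pos by (simp add: XAE algebra_simps)
  have 8: "43 / 16 * E \<le> 43 / 16 * \<gamma> / \<epsilon> * e\<^sup>2"
    using mult_left_mono[OF \<eta>(3), of "43 / 16 * \<gamma> * e\<^sup>2"] pos by (simp add: XAE algebra_simps)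
  show ?thesis
    using 1 2 3 4 5 6 7 8 by linarith
qed

section \<open>Coordinates, norms and batch averages\<close>

lemma borel_measurable_vec_nth [measurable (raw)]:
  fixes X :: "'a \<Rightarrow> real ^ 'n"
  shows "X \<in> borel_measurable N \<Longrightarrow> (\<lambda>\<omega>. X \<omega> $ i) \<in> borel_measurable N"
  by (erule measurable_compose) (intro borel_measurable_continuous_onI continuous_intros)

lemma borel_measurable_vec_lambda [measurable (raw)]:
  fixes X :: "'n::finite \<Rightarrow> 'a \<Rightarrow> real"
  assumes [measurable]: "\<And>i. X i \<in> borel_measurable N"
  shows "(\<lambda>\<omega>. \<chi> i. X i \<omega>) \<in> borel_measurable N"
proof (rule borel_measurable_euclidean_space[THEN iffD2], rule ballI)
  fix v :: "real ^ 'n" assume "v \<in> Basis"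
  then obtain i where "v = axis i 1" by (auto simp: Basis_vec_def)
  then show "(\<lambda>\<omega>. (\<chi> i. X i \<omega>) \<bullet> v) \<in> borel_measurable N"
    by (simp add: inner_axis)
qed

lemma borel_measurable_vec_times [measurable (raw)]:
  fixes X Y :: "'a \<Rightarrow> real ^ 'n"
  assumes [measurable]: "X \<in> borel_measurable N" "Y \<in> borel_measurable N"
  shows "(\<lambda>\<omega>. X \<omega> * Y \<omega>) \<in> borel_measurable N"
  unfolding times_vec_def by measurable

text \<open>Passes through the l1 norm. The factor is crude, but the bound serves only to establish
  integrability.\<close>

lemma norm_vec_le_componentwise:
  fixes x :: "real ^ 'n"
  assumes "\<And>i. \<bar>x $ i\<bar> \<le> c"
  shows "norm x \<le> real CARD('n) * c"
  using norm_le_l1_cart[of x] sum_bounded_above[of UNIV "\<lambda>i. \<bar>x $ i\<bar>" c] assms by simp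

lemma norm_vec_squared:
  fixes x :: "real ^ 'n"
  shows "(norm x)\<^sup>2 = (\<Sum>i\<in>UNIV. (x $ i)\<^sup>2)"
  by (simp add: power2_norm_eq_inner inner_vec_def) (simp add: power2_eq_square)

lemma batch_grad_cong:
  "(\<And>i. i < b \<Longrightarrow> Y i = Z i) \<Longrightarrow> batch_grad f b Y x = batch_grad f b Z x"
  unfolding batch_grad_def by (intro arg_cong[where f = "scaleR _"] sum.cong) auto

lemma sam_grad_cong:
  "(\<And>i. i < b \<Longrightarrow> Y i = Z i) \<Longrightarrow> sam_grad \<rho> f b Y x = sam_grad \<rho> f b Z x"
  using batch_grad_cong[of b Y Z f] unfolding sam_grad_def by simp

text \<open>The state entering iteration \<open>t\<close> reads only the batches before
  \<open>t\<close>. It is therefore a function of the past samples, which is what the independence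
  argument requires.\<close>

lemma adasam_state_cong:
  assumes "\<And>s i. s < t \<Longrightarrow> i < b \<Longrightarrow> Y s i = Z s i"
  shows "adasam_state \<gamma> \<rho> \<beta>1 \<beta>2 \<epsilon> f b x0 Y t = adasam_state \<gamma> \<rho> \<beta>1 \<beta>2 \<epsilon> f b x0 Z t"
  using assms
proof (induction t)
  case (Suc t)
  have "sam_grad \<rho> f b (Y t) = sam_grad \<rho> f b (Z t)"
    using Suc.prems by (intro ext sam_grad_cong) auto
  with Suc show ?case by simp
qed simp

lemma mean_component_bounded:
  fixes v :: "nat \<Rightarrow> real ^ 'n"
  assumes "0 < b" "\<And>i. i < b \<Longrightarrow> \<bar>v i $ j\<bar> \<le> G"
  shows "\<bar>((1 / real b) *\<^sub>R (\<Sum>i<b. v i)) $ j\<bar> \<le> G"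
proof -
  have "\<bar>(\<Sum>i<b. v i) $ j\<bar> \<le> (\<Sum>i<b. \<bar>v i $ j\<bar>)"
    by simp
  also have "\<dots> \<le> real b * G"
    using sum_bounded_above[of "{..<b}" "\<lambda>i. \<bar>v i $ j\<bar>" G] assms(2) by simp
  finally show ?thesis
    using assms(1) by (simp add: abs_mult field_simps)
qed

lemma norm_batch_grad_diff_le:
  assumes "0 < b" and "\<And>i. i < b \<Longrightarrow> norm (gradient (f (Y i)) x - gradient (f (Y i)) y) \<le> c"
  shows "norm (batch_grad f b Y x - batch_grad f b Y y) \<le> c"
proof -
  have "norm (\<Sum>i<b. gradient (f (Y i)) x - gradient (f (Y i)) y) \<le> real b * c"
    using sum_norm_bound[of "{..<b}" "\<lambda>i. gradient (f (Y i)) x - gradient (f (Y i)) y" c] assms(2) by simp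
  moreover have "batch_grad f b Y x - batch_grad f b Y y
      = (1 / real b) *\<^sub>R (\<Sum>i<b. gradient (f (Y i)) x - gradient (f (Y i)) y)"
    by (simp add: batch_grad_def sum_subtractf scaleR_diff_right)
  ultimately show ?thesis
    using assms(1) by (simp add: divide_le_eq mult.commute)
qed

text \<open>A function of the second-moment vector, so that it can be applied to any state. The
  state at index \<open>t\<close> carries the vector of iteration \<open>t - 1\<close>, hence yields
  the old step size.\<close>

definition step_size :: "real ^ 'n \<Rightarrow> real ^ 'n" where
  "step_size vhat = (\<chi> i. 1 / sqrt (vhat $ i))"

lemma step_size_bounds:
  assumes "0 < \<epsilon>" "0 < G" "\<epsilon>\<^sup>2 \<le> vhat $ i" "vhat $ i \<le> G\<^sup>2"
  shows "1 / G \<le> step_size vhat $ i" "step_size vhat $ i \<le> 1 / \<epsilon>"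
proof -
  have "\<epsilon> \<le> sqrt (vhat $ i)" "sqrt (vhat $ i) \<le> G"
    using assms by (auto intro!: real_le_rsqrt real_le_lsqrt)
  moreover have "0 < vhat $ i"
    using assms zero_less_power[OF assms(1), of 2] by linarith
  ultimately show "1 / G \<le> step_size vhat $ i" "step_size vhat $ i \<le> 1 / \<epsilon>"
    using assms by (auto simp: step_size_def intro!: divide_left_mono mult_pos_pos)
qed

text \<open>Unprefixed probabilistic notions such as \<open>expectation\<close> refer to
  \<open>M\<close>, the randomness of the whole run; those of the sample law carry the prefix
  \<open>D\<close>.\<close>

locale adasam = D: prob_space D + prob_space M
  for D :: "'a measure" and M :: "'w measure" +
  fixes f :: "'a \<Rightarrow> real ^ 'n \<Rightarrow> real"
    and B :: "'w \<Rightarrow> nat \<Rightarrow> nat \<Rightarrow> 'a"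
    and x0 :: "real ^ 'n"
    and L \<sigma> G \<gamma> \<rho> \<beta>1 \<beta>2 \<epsilon> :: real
    and b :: nat
  assumes integrable_loss: "\<And>y. integrable D (\<lambda>\<xi>. f \<xi> y)"
    and differentiable_loss: "\<And>\<xi> y. \<xi> \<in> space D \<Longrightarrow> f \<xi> differentiable (at y)"
    and differentiable_expected_loss: "\<And>y. expected_loss D f differentiable (at y)"
    and L_pos: "0 < L" and smooth: "smooth_losses L D f"
    and variance: "bounded_variance \<sigma> D f"
    and batch_variance: "\<And>t. bounded_batch_variance \<sigma> M D f b (\<lambda>\<omega>. B \<omega> t)"
    and bounded_grad: "bounded_gradients G D f"
    and b_pos: "0 < b" and iid: "iid_batches M D b B"
    and \<rho>_nonneg: "0 \<le> \<rho>"
    and \<beta>1: "0 \<le> \<beta>1" "\<beta>1 < 1" and \<beta>2: "0 \<le> \<beta>2" "\<beta>2 \<le> 1"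
    and \<epsilon>: "0 < \<epsilon>" "\<epsilon> \<le> G"
    and \<gamma>: "0 < \<gamma>" "\<gamma> \<le> \<epsilon> / (16 * L)"
begin

abbreviation "F \<equiv> expected_loss D f"
abbreviation "\<kappa> \<equiv> \<beta>1 / (1 - \<beta>1)"
abbreviation "state \<equiv> adasam_state \<gamma> \<rho> \<beta>1 \<beta>2 \<epsilon> f b x0"

text \<open>
  This is \<open>z\<^sub>t\<close>: by the update rule \<open>x\<^sub>t - x\<^sub>t\<^sub>-\<^sub>1 = - \<gamma> m\<^sub>t\<^sub>-\<^sub>1 \<eta>\<^sub>t\<^sub>-\<^sub>1\<close>, so it is a function of the state.
\<close>
definition lookahead :: "(real ^ 'n) \<times> (real ^ 'n) \<times> (real ^ 'n) \<times> (real ^ 'n) \<Rightarrow> real ^ 'n" where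
  "lookahead = (\<lambda>(x, m, v, vhat). x - (\<kappa> * \<gamma>) *\<^sub>R (m * step_size vhat))"

text \<open>The two weights are the coefficients of \<open>\<eta>' - \<eta>\<close> and of the
  difference of squares in the coordinate estimate, so the decrease of the two sums pays exactly for
  those terms.\<close>

definition potential :: "(real ^ 'n) \<times> (real ^ 'n) \<times> (real ^ 'n) \<times> (real ^ 'n) \<Rightarrow> real" where
  "potential = (\<lambda>p. case p of (x, m, v, vhat) \<Rightarrow>
     F (lookahead p) + \<gamma> * G\<^sup>2 * (1 + \<kappa>) * (\<Sum>i\<in>UNIV. step_size vhat $ i)
       + L * \<gamma>\<^sup>2 * \<kappa>\<^sup>2 * G\<^sup>2 * (\<Sum>i\<in>UNIV. (step_size vhat $ i)\<^sup>2))"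

text \<open>The state \<open>p\<close> and the batch gradient \<open>s\<close> are separate
  arguments so that \<open>p\<close> can be frozen. The step size taken from \<open>p\<close> is the
  old one, so every factor multiplying the sampling error is then constant.\<close>

definition noise :: "(real ^ 'n) \<times> (real ^ 'n) \<times> (real ^ 'n) \<times> (real ^ 'n) \<Rightarrow> real ^ 'n \<Rightarrow> real" where
  "noise = (\<lambda>p s. case p of (x, m, v, vhat) \<Rightarrow>
     - \<gamma> * ((step_size vhat * gradient F (lookahead p)) \<bullet> (s - gradient F x))
       + 3 * L * \<gamma>\<^sup>2 / \<epsilon>\<^sup>2 * (norm (s - gradient F x))\<^sup>2)"

definition bounded_state :: "(real ^ 'n) \<times> (real ^ 'n) \<times> (real ^ 'n) \<times> (real ^ 'n) \<Rightarrow> bool" where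
  "bounded_state = (\<lambda>(x, m, v, vhat). \<forall>i. \<bar>m $ i\<bar> \<le> G \<and> v $ i \<le> G\<^sup>2 \<and> \<epsilon>\<^sup>2 \<le> vhat $ i \<and> vhat $ i \<le> G\<^sup>2)"

section \<open>Bounds on gradients, perturbation and state\<close>

lemma G_pos: "0 < G" using \<epsilon> by simp

lemma \<kappa>_nonneg: "0 \<le> \<kappa>" using \<beta>1 by simp

lemma gradient_component_bounded: "\<xi> \<in> space D \<Longrightarrow> \<bar>gradient (f \<xi>) x $ i\<bar> \<le> G"
  using bounded_grad component_le_infnorm_cart[of "gradient (f \<xi>) x" i]
  unfolding bounded_gradients_def by (meson order_trans)

lemma gradient_lipschitz:
  "\<xi> \<in> space D \<Longrightarrow> norm (gradient (f \<xi>) x - gradient (f \<xi>) y) \<le> L * norm (x - y)"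
  using smooth unfolding smooth_losses_def by blast

lemma expected_gradient_lipschitz: "norm (gradient F x - gradient F y) \<le> L * norm (x - y)"
  using smooth unfolding smooth_losses_def by blast

lemma measurable_gradient_at: "(\<lambda>\<xi>. gradient (f \<xi>) x) \<in> borel_measurable D"
  by (rule borel_measurable_gradient) (use integrable_loss differentiable_loss in auto)

lemma integrable_gradient: "integrable D (\<lambda>\<xi>. gradient (f \<xi>) x)"
  using norm_vec_le_componentwise[OF gradient_component_bounded]
  by (intro D.integrable_const_bound[where B = "real CARD('n) * G"] AE_I2 measurable_gradient_at) auto

lemma expected_gradient: "(\<integral>\<xi>. gradient (f \<xi>) x \<partial>D) = gradient F x"
  using variance unfolding bounded_variance_def by blast

text \<open>The bound is assumed for sample gradients only; it passes to the expected loss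
  coordinate by coordinate, because its gradient is their mean.\<close>

lemma expected_gradient_component_bounded: "\<bar>gradient F x $ i\<bar> \<le> G"
proof -
  have "gradient F x $ i = (\<integral>\<xi>. gradient (f \<xi>) x $ i \<partial>D)"
    unfolding expected_gradient[symmetric]
    by (rule integral_bounded_linear[OF bounded_linear_vec_nth integrable_gradient, symmetric])
  moreover have "integrable D (\<lambda>\<xi>. gradient (f \<xi>) x $ i)"
    by (rule integrable_bounded_linear[OF bounded_linear_vec_nth integrable_gradient])
  ultimately show ?thesis
    using gradient_component_bounded[of _ x i]
    by (auto simp: abs_le_iff minus_le_iff intro!: D.integral_le_const D.integral_ge_const AE_I2)
qed

lemma batch_grad_component_bounded:
  "(\<And>i. i < b \<Longrightarrow> Y i \<in> space D) \<Longrightarrow> \<bar>batch_grad f b Y x $ j\<bar> \<le> G"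
  unfolding batch_grad_def using b_pos
  by (intro mean_component_bounded gradient_component_bounded) auto

lemma sam_grad_component_bounded:
  "(\<And>i. i < b \<Longrightarrow> Y i \<in> space D) \<Longrightarrow> \<bar>sam_grad \<rho> f b Y x $ j\<bar> \<le> G"
  unfolding sam_grad_def Let_def by (rule batch_grad_component_bounded)

text \<open>Both gradients use the same batch, so the Lipschitz bound applies sample by sample. The
  perturbation has norm at most \<open>\<rho>\<close>, also when the batch gradient is 0, where it
  vanishes.\<close>

lemma norm_sam_grad_diff_le:
  assumes "\<And>i. i < b \<Longrightarrow> Y i \<in> space D"
  shows "norm (sam_grad \<rho> f b Y x - batch_grad f b Y x) \<le> L * \<rho>"
  unfolding sam_grad_def Let_def
proof (rule norm_batch_grad_diff_le[OF b_pos])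
  let ?s = "batch_grad f b Y x"
  let ?d = "(\<rho> / norm ?s) *\<^sub>R ?s"
  fix i assume "i < b"
  have "norm ?d \<le> \<rho>" using \<rho>_nonneg by simp
  then have "L * norm ?d \<le> L * \<rho>" using L_pos by simp
  moreover have "norm (gradient (f (Y i)) (x + ?d) - gradient (f (Y i)) x) \<le> L * norm ?d"
    using gradient_lipschitz[OF assms[OF \<open>i < b\<close>], of "x + ?d" x] by simp
  ultimately show "norm (gradient (f (Y i)) (x + ?d) - gradient (f (Y i)) x) \<le> L * \<rho>"
    by simp
qed

text \<open>Convex combinations preserve the bounds on \<open>m\<close> and \<open>v\<close>, and
  the entrywise maximum keeps \<open>vhat\<close> in its interval; the initial value lies there
  because \<open>\<epsilon> \<le> G\<close>.\<close>

lemma bounded_state: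
  assumes Y: "\<And>t i. i < b \<Longrightarrow> Y t i \<in> space D"
  shows "bounded_state (state Y t)"
proof (induction t)
  case 0
  show ?case using \<epsilon> by (simp add: bounded_state_def power_mono)
next
  case (Suc t)
  obtain x m v vhat where S: "state Y t = (x, m, v, vhat)" by (metis prod_cases4)
  define g where "g = sam_grad \<rho> f b (Y t) x"
  have g: "\<bar>g $ i\<bar> \<le> G" for i
    unfolding g_def using Y by (rule sam_grad_component_bounded)
  have "\<bar>\<beta>1 * m $ i + (1 - \<beta>1) * g $ i\<bar> \<le> G" for i
  proof -
    have "\<bar>\<beta>1 * m $ i + (1 - \<beta>1) * g $ i\<bar> \<le> \<beta>1 * \<bar>m $ i\<bar> + (1 - \<beta>1) * \<bar>g $ i\<bar>"
      using \<beta>1 by (intro order_trans[OF abs_triangle_ineq]) (simp add: abs_mult)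
    also have "\<dots> \<le> G"
      using Suc g[of i] \<beta>1 by (intro convex_bound_le) (auto simp: S bounded_state_def)
    finally show ?thesis .
  qed
  moreover have v: "\<beta>2 * v $ i + (1 - \<beta>2) * (g $ i)\<^sup>2 \<le> G\<^sup>2" for i
    using Suc g[of i] G_pos \<beta>2
    by (intro convex_bound_le) (auto simp: S bounded_state_def abs_le_square_iff[symmetric])
  moreover have "\<epsilon>\<^sup>2 \<le> max (vhat $ i) (\<beta>2 * v $ i + (1 - \<beta>2) * (g $ i)\<^sup>2)
      \<and> max (vhat $ i) (\<beta>2 * v $ i + (1 - \<beta>2) * (g $ i)\<^sup>2) \<le> G\<^sup>2" for i
    using Suc v[of i] by (auto simp: S bounded_state_def le_max_iff_disj)
  ultimately show ?case
    by (simp add: bounded_state_def S Let_def power2_eq_square flip: g_def)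
qed

text \<open>Holds for every sample sequence, without averaging. The descent lemma is applied from
  \<open>z\<close> to \<open>z'\<close>, and the coordinate estimate is summed. The first constant
  comes from the distance between \<open>z\<close> and \<open>x\<close>, the second from the
  perturbation.\<close>

lemma potential_decrease:
  assumes Y: "\<And>t i. i < b \<Longrightarrow> Y t i \<in> space D"
  shows "potential (state Y (Suc t)) \<le> potential (state Y t)
    - \<gamma> / (2 * G) * (norm (gradient F (fst (state Y t))))\<^sup>2
    + (5 / 2 * \<gamma> / \<epsilon> * (L\<^sup>2 * (\<kappa>\<^sup>2 * \<gamma>\<^sup>2 * (real CARD('n) * (G\<^sup>2 / \<epsilon>\<^sup>2)))) + 43 / 16 * \<gamma> / \<epsilon> * (L\<^sup>2 * \<rho>\<^sup>2))
    + noise (state Y t) (batch_grad f b (Y t) (fst (state Y t)))"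
proof -
  obtain x m v vhat where S: "state Y t = (x, m, v, vhat)" by (metis prod_cases4)
  obtain x' m' v' vhat' where S': "state Y (Suc t) = (x', m', v', vhat')" by (metis prod_cases4)
  define g where "g = sam_grad \<rho> f b (Y t) x"
  define s where "s = batch_grad f b (Y t) x"
  define \<eta> where "\<eta> = step_size vhat'"
  define \<eta>' where "\<eta>' = step_size vhat"
  define z where "z = lookahead (state Y t)"
  define z' where "z' = lookahead (state Y (Suc t))"
  define P where "P = gradient F z"
  define Q where "Q = gradient F x"
  define w where "w = z' - z"
  have m': "m' = \<beta>1 *\<^sub>R m + (1 - \<beta>1) *\<^sub>R g" and x': "x' = x - \<gamma> *\<^sub>R (m' * \<eta>)"
    and vhat': "vhat $ i \<le> vhat' $ i" for i
    using S' by (auto simp: S Let_def g_def \<eta>_def step_size_def)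
  have bd: "bounded_state (x, m, v, vhat)" "bounded_state (x', m', v', vhat')"
    using bounded_state[of Y t, OF Y] bounded_state[of Y "Suc t", OF Y] unfolding S S' by auto
  have \<eta>: "1 / G \<le> \<eta> $ i" "\<eta> $ i \<le> \<eta>' $ i" "\<eta>' $ i \<le> 1 / \<epsilon>" for i
  proof -
    show "1 / G \<le> \<eta> $ i" "\<eta>' $ i \<le> 1 / \<epsilon>"
      unfolding \<eta>_def \<eta>'_def
      by (rule step_size_bounds[OF \<epsilon>(1) G_pos]; use bd in \<open>simp add: bounded_state_def\<close>)+
    have "0 < \<epsilon>\<^sup>2" "\<epsilon>\<^sup>2 \<le> vhat $ i" using \<epsilon> bd by (auto simp: bounded_state_def)
    then have "0 < vhat $ i" by linarith
    then show "\<eta> $ i \<le> \<eta>' $ i"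
      using vhat'[of i] by (auto simp: \<eta>_def \<eta>'_def step_size_def intro!: divide_left_mono)
  qed
  have z: "z = x - (\<kappa> * \<gamma>) *\<^sub>R (m * \<eta>')" and z': "z' = x' - (\<kappa> * \<gamma>) *\<^sub>R (m' * \<eta>)"
    unfolding z_def z'_def S S' \<eta>_def \<eta>'_def by (simp_all add: lookahead_def)
  have w: "w $ i = - \<gamma> * g $ i * \<eta> $ i + \<gamma> * \<kappa> * m $ i * (\<eta>' $ i - \<eta> $ i)" for i
  proof -
    \<comment> \<open>This identity dictates the value of \<kappa>: since
      \<open>1 + \<kappa> = 1 / (1 - \<beta>1)\<close>, the new momentum scaled by it contains the
      fresh gradient with weight 1.\<close>
    have "(1 + \<kappa>) * m' $ i = \<kappa> * m $ i + g $ i"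
      using \<beta>1 by (simp add: m' field_simps)
    \<comment> \<open>Replacing the fraction by a variable \<open>k\<close> turns the claim into a
      polynomial identity.\<close>
    moreover have "w $ i = - (\<gamma> * \<eta> $ i) * ((1 + k) * m' $ i) + k * \<gamma> * m $ i * \<eta>' $ i" if "k = \<kappa>" for k
      unfolding w_def z z' x' that[symmetric] by (simp add: algebra_simps)
    ultimately have "w $ i = - (\<gamma> * \<eta> $ i) * (\<kappa> * m $ i + g $ i) + \<kappa> * \<gamma> * m $ i * \<eta>' $ i"
      by metis
    also have "\<dots> = - \<gamma> * g $ i * \<eta> $ i + \<gamma> * k * m $ i * (\<eta>' $ i - \<eta> $ i)" if "k = \<kappa>" for k
      unfolding that[symmetric] by (simp add: algebra_simps)
    finally show ?thesis by simp
  qed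
  \<comment> \<open>\<open>z - x\<close> is a multiple of the product of \<open>m\<close> and the
    old step size, whose entries are at most \<open>G / \<epsilon>\<close> in absolute value.
    Summing over coordinates brings in the dimension.\<close>
  have a: "(\<Sum>i\<in>UNIV. (P $ i - Q $ i)\<^sup>2) \<le> L\<^sup>2 * (\<kappa>\<^sup>2 * \<gamma>\<^sup>2 * (real CARD('n) * (G\<^sup>2 / \<epsilon>\<^sup>2)))"
  proof -
    have "(m $ i * \<eta>' $ i)\<^sup>2 \<le> G\<^sup>2 / \<epsilon>\<^sup>2" for i
    proof -
      have "0 \<le> \<eta>' $ i" using \<eta>[of i] G_pos by (smt (verit) divide_pos_pos)
      then have "\<bar>m $ i * \<eta>' $ i\<bar> \<le> G * (1 / \<epsilon>)"
        unfolding abs_mult using bd \<eta>(3)[of i] G_pos by (intro mult_mono) (auto simp: bounded_state_def)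
      then have "(m $ i * \<eta>' $ i)\<^sup>2 \<le> (G / \<epsilon>)\<^sup>2"
        using G_pos \<epsilon> by (simp add: abs_le_square_iff[symmetric])
      then show ?thesis by (simp add: power_divide)
    qed
    then have m\<eta>': "(norm (m * \<eta>'))\<^sup>2 \<le> real CARD('n) * (G\<^sup>2 / \<epsilon>\<^sup>2)"
      unfolding norm_vec_squared
      using sum_bounded_above[of UNIV "\<lambda>i. ((m * \<eta>') $ i)\<^sup>2" "G\<^sup>2 / \<epsilon>\<^sup>2"] by simp
    have "z - x = - ((\<kappa> * \<gamma>) *\<^sub>R (m * \<eta>'))"
      by (simp add: z)
    then have zx: "(norm (z - x))\<^sup>2 = \<kappa>\<^sup>2 * \<gamma>\<^sup>2 * (norm (m * \<eta>'))\<^sup>2"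
      by (simp only: norm_minus_cancel norm_scaleR power_mult_distrib power2_abs)
    have "(norm (z - x))\<^sup>2 \<le> \<kappa>\<^sup>2 * \<gamma>\<^sup>2 * (real CARD('n) * (G\<^sup>2 / \<epsilon>\<^sup>2))"
      unfolding zx by (rule mult_left_mono[OF m\<eta>']) simp
    moreover have "(norm (P - Q))\<^sup>2 \<le> L\<^sup>2 * (norm (z - x))\<^sup>2"
      unfolding P_def Q_def power_mult_distrib[symmetric]
      by (intro power_mono expected_gradient_lipschitz) simp
    ultimately have "(norm (P - Q))\<^sup>2 \<le> L\<^sup>2 * (\<kappa>\<^sup>2 * \<gamma>\<^sup>2 * (real CARD('n) * (G\<^sup>2 / \<epsilon>\<^sup>2)))"
      by (meson mult_left_mono order_trans zero_le_power2)
    then show ?thesis by (simp add: norm_vec_squared)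
  qed
  have e: "(\<Sum>i\<in>UNIV. (g $ i - s $ i)\<^sup>2) \<le> L\<^sup>2 * \<rho>\<^sup>2"
  proof -
    have "(norm (g - s))\<^sup>2 \<le> (L * \<rho>)\<^sup>2"
      unfolding g_def s_def using Y by (intro power_mono norm_sam_grad_diff_le) auto
    then show ?thesis by (simp add: norm_vec_squared power_mult_distrib)
  qed
  let ?cS = "\<gamma> * G\<^sup>2 * (1 + \<kappa>)" and ?cQ = "L * \<gamma>\<^sup>2 * \<kappa>\<^sup>2 * G\<^sup>2"
  have "P $ i * w $ i + L / 2 * (w $ i)\<^sup>2 \<le> - \<gamma> / (2 * G) * (Q $ i)\<^sup>2
      + 5 / 2 * \<gamma> / \<epsilon> * (P $ i - Q $ i)\<^sup>2 + 43 / 16 * \<gamma> / \<epsilon> * (g $ i - s $ i)\<^sup>2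
      + ?cS * (\<eta>' $ i - \<eta> $ i) + ?cQ * ((\<eta>' $ i)\<^sup>2 - (\<eta> $ i)\<^sup>2)
      - \<gamma> * \<eta>' $ i * P $ i * (s $ i - Q $ i) + 3 * L * \<gamma>\<^sup>2 / \<epsilon>\<^sup>2 * (s $ i - Q $ i)\<^sup>2" for i
  proof -
    have "\<bar>P $ i\<bar> \<le> G" "\<bar>g $ i\<bar> \<le> G" "\<bar>m $ i\<bar> \<le> G"
      unfolding P_def g_def using Y bd
      by (auto intro: expected_gradient_component_bounded sam_grad_component_bounded simp: bounded_state_def)
    then show ?thesis
      using adaptive_step_coordinate_bound[of "Q $ i" "P $ i - Q $ i" G "s $ i - Q $ i" "g $ i - s $ i" "m $ i"
          "\<eta> $ i" "\<eta>' $ i" \<epsilon> \<gamma> \<kappa> L] \<eta>[of i] \<epsilon> G_pos \<gamma> \<kappa>_nonneg L_pos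
      by (simp add: w)
  qed
  then have "(\<Sum>i\<in>UNIV. P $ i * w $ i + L / 2 * (w $ i)\<^sup>2) \<le> (\<Sum>i\<in>UNIV. - \<gamma> / (2 * G) * (Q $ i)\<^sup>2
      + 5 / 2 * \<gamma> / \<epsilon> * (P $ i - Q $ i)\<^sup>2 + 43 / 16 * \<gamma> / \<epsilon> * (g $ i - s $ i)\<^sup>2
      + ?cS * (\<eta>' $ i - \<eta> $ i) + ?cQ * ((\<eta>' $ i)\<^sup>2 - (\<eta> $ i)\<^sup>2)
      - \<gamma> * \<eta>' $ i * P $ i * (s $ i - Q $ i) + 3 * L * \<gamma>\<^sup>2 / \<epsilon>\<^sup>2 * (s $ i - Q $ i)\<^sup>2)"
    by (rule sum_mono)
  also have "\<dots> = - \<gamma> / (2 * G) * (\<Sum>i\<in>UNIV. (Q $ i)\<^sup>2)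
      + 5 / 2 * \<gamma> / \<epsilon> * (\<Sum>i\<in>UNIV. (P $ i - Q $ i)\<^sup>2) + 43 / 16 * \<gamma> / \<epsilon> * (\<Sum>i\<in>UNIV. (g $ i - s $ i)\<^sup>2)
      + ?cS * ((\<Sum>i\<in>UNIV. \<eta>' $ i) - (\<Sum>i\<in>UNIV. \<eta> $ i))
      + ?cQ * ((\<Sum>i\<in>UNIV. (\<eta>' $ i)\<^sup>2) - (\<Sum>i\<in>UNIV. (\<eta> $ i)\<^sup>2))
      - \<gamma> * (\<Sum>i\<in>UNIV. \<eta>' $ i * P $ i * (s $ i - Q $ i)) + 3 * L * \<gamma>\<^sup>2 / \<epsilon>\<^sup>2 * (\<Sum>i\<in>UNIV. (s $ i - Q $ i)\<^sup>2)"
    by (simp only: sum.distrib sum_subtractf sum_distrib_left[symmetric] mult.assoc)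
  \<comment> \<open>Only the two error sums are estimated. The step size differences stay exact in
    order to telescope, and the noise stays exact in order to be averaged.\<close>
  also have "\<dots> \<le> - \<gamma> / (2 * G) * (\<Sum>i\<in>UNIV. (Q $ i)\<^sup>2)
      + 5 / 2 * \<gamma> / \<epsilon> * (L\<^sup>2 * (\<kappa>\<^sup>2 * \<gamma>\<^sup>2 * (real CARD('n) * (G\<^sup>2 / \<epsilon>\<^sup>2)))) + 43 / 16 * \<gamma> / \<epsilon> * (L\<^sup>2 * \<rho>\<^sup>2)
      + ?cS * ((\<Sum>i\<in>UNIV. \<eta>' $ i) - (\<Sum>i\<in>UNIV. \<eta> $ i))
      + ?cQ * ((\<Sum>i\<in>UNIV. (\<eta>' $ i)\<^sup>2) - (\<Sum>i\<in>UNIV. (\<eta> $ i)\<^sup>2))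
      - \<gamma> * (\<Sum>i\<in>UNIV. \<eta>' $ i * P $ i * (s $ i - Q $ i)) + 3 * L * \<gamma>\<^sup>2 / \<epsilon>\<^sup>2 * (\<Sum>i\<in>UNIV. (s $ i - Q $ i)\<^sup>2)"
    using a e \<gamma> \<epsilon> by (intro add_mono diff_mono mult_left_mono order_refl) auto
  finally have main: "(\<Sum>i\<in>UNIV. P $ i * w $ i + L / 2 * (w $ i)\<^sup>2) \<le> \<dots>" .
  have "F z' \<le> F z + P \<bullet> w + L / 2 * (norm w)\<^sup>2"
    unfolding P_def w_def
    by (rule lipschitz_gradient_upper_bound[OF differentiable_expected_loss expected_gradient_lipschitz])
  also have "\<dots> = F z + (\<Sum>i\<in>UNIV. P $ i * w $ i + L / 2 * (w $ i)\<^sup>2)"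
    by (simp add: inner_vec_def norm_vec_squared sum.distrib sum_distrib_left)
  finally have "F z' \<le> F z + (\<Sum>i\<in>UNIV. P $ i * w $ i + L / 2 * (w $ i)\<^sup>2)" .
  moreover have "potential (state Y (Suc t)) = F z' + ?cS * (\<Sum>i\<in>UNIV. \<eta> $ i) + ?cQ * (\<Sum>i\<in>UNIV. (\<eta> $ i)\<^sup>2)"
    "potential (state Y t) = F z + ?cS * (\<Sum>i\<in>UNIV. \<eta>' $ i) + ?cQ * (\<Sum>i\<in>UNIV. (\<eta>' $ i)\<^sup>2)"
    unfolding z_def z'_def S S' \<eta>_def \<eta>'_def by (simp_all add: potential_def)
  moreover have "noise (state Y t) (batch_grad f b (Y t) (fst (state Y t)))
      = - \<gamma> * (\<Sum>i\<in>UNIV. \<eta>' $ i * P $ i * (s $ i - Q $ i)) + 3 * L * \<gamma>\<^sup>2 / \<epsilon>\<^sup>2 * (\<Sum>i\<in>UNIV. (s $ i - Q $ i)\<^sup>2)"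
    unfolding z_def s_def Q_def P_def \<eta>'_def S
    by (simp add: noise_def inner_vec_def norm_vec_squared)
  moreover have "(norm (gradient F (fst (state Y t))))\<^sup>2 = (\<Sum>i\<in>UNIV. (Q $ i)\<^sup>2)"
    by (simp add: S Q_def norm_vec_squared)
  ultimately show ?thesis
    using main by (simp add: right_diff_distrib)
qed

section \<open>Taking expectations\<close>

lemma sample_in_space:
  assumes "\<omega> \<in> space M" "i < b"
  shows "B \<omega> t i \<in> space D"
proof -
  have "random_variable D (\<lambda>\<omega>. B \<omega> t i)"
    using iid assms(2) by (auto simp: iid_batches_def indep_vars_def2 dest!: bspec[where x = "(t, i)"])
  then show ?thesis using assms(1) by (rule measurable_space)
qed

section \<open>Measurability of the run\<close>

lemma measurable_gradient [measurable (raw)]: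
  "X \<in> measurable N D \<Longrightarrow> Y \<in> borel_measurable N \<Longrightarrow> (\<lambda>\<omega>. gradient (f (X \<omega>)) (Y \<omega>)) \<in> borel_measurable N"
proof (rule borel_measurable_caratheodory[where g = "\<lambda>\<xi>. gradient (f \<xi>)", OF measurable_gradient_at])
  fix \<xi> assume "\<xi> \<in> space D"
  then have "L-lipschitz_on UNIV (gradient (f \<xi>))"
    using gradient_lipschitz L_pos by (intro lipschitz_onI) (auto simp: dist_norm)
  then show "continuous_on UNIV (gradient (f \<xi>))"
    by (rule lipschitz_on_continuous_on)
qed

lemma measurable_expected_gradient [measurable (raw)]:
  assumes "Y \<in> borel_measurable N"
  shows "(\<lambda>\<omega>. gradient F (Y \<omega>)) \<in> borel_measurable N"
proof -
  have "L-lipschitz_on UNIV (gradient F)"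
    using expected_gradient_lipschitz L_pos by (intro lipschitz_onI) (auto simp: dist_norm)
  then show ?thesis
    by (rule borel_measurable_continuous_on[OF lipschitz_on_continuous_on assms])
qed

lemma measurable_batch_grad:
  assumes "\<And>i. i < b \<Longrightarrow> (\<lambda>\<omega>. Y \<omega> i) \<in> measurable N D" "X \<in> borel_measurable N"
  shows "(\<lambda>\<omega>. batch_grad f b (Y \<omega>) (X \<omega>)) \<in> borel_measurable N"
  unfolding batch_grad_def using assms
  by (intro borel_measurable_scaleR borel_measurable_const borel_measurable_sum measurable_gradient) auto

lemma measurable_sam_grad:
  assumes [measurable]: "\<And>i. i < b \<Longrightarrow> (\<lambda>\<omega>. Y \<omega> i) \<in> measurable N D" "X \<in> borel_measurable N"
  shows "(\<lambda>\<omega>. sam_grad \<rho> f b (Y \<omega>) (X \<omega>)) \<in> borel_measurable N"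
proof -
  have [measurable]: "(\<lambda>\<omega>. batch_grad f b (Y \<omega>) (X \<omega>)) \<in> borel_measurable N"
    using assms by (rule measurable_batch_grad)
  show ?thesis
    unfolding sam_grad_def Let_def
    by (rule measurable_batch_grad) measurable
qed

text \<open>Stated for samples over an arbitrary space \<open>N\<close>, because it is used both on
  \<open>M\<close> and on the product space of past and present samples.\<close>

lemma measurable_state:
  assumes "\<And>s i. s < t \<Longrightarrow> i < b \<Longrightarrow> (\<lambda>\<omega>. Y \<omega> s i) \<in> measurable N D"
  shows "(\<lambda>\<omega>. state (Y \<omega>) t) \<in> borel_measurable N"
  using assms
proof (induction t)
  case (Suc t)
  then have S: "(\<lambda>\<omega>. state (Y \<omega>) t) \<in> borel_measurable N" by simp
  define x where "x \<omega> = fst (state (Y \<omega>) t)" for \<omega>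
  define m where "m \<omega> = fst (snd (state (Y \<omega>) t))" for \<omega>
  define v where "v \<omega> = fst (snd (snd (state (Y \<omega>) t)))" for \<omega>
  define vhat where "vhat \<omega> = snd (snd (snd (state (Y \<omega>) t)))" for \<omega>
  have state_t: "state (Y \<omega>) t = (x \<omega>, m \<omega>, v \<omega>, vhat \<omega>)" for \<omega>
    by (simp add: x_def m_def v_def vhat_def)
  have [measurable]: "x \<in> borel_measurable N" "m \<in> borel_measurable N" "v \<in> borel_measurable N"
      "vhat \<in> borel_measurable N"
    unfolding x_def m_def v_def vhat_def
    by (rule borel_measurable_continuous_on[OF _ S]; intro continuous_intros)+
  have [measurable]: "(\<lambda>\<omega>. sam_grad \<rho> f b (Y \<omega> t) (x \<omega>)) \<in> borel_measurable N"
    by (rule measurable_sam_grad) (use Suc.prems in auto)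
  show ?case
    unfolding adasam_state.simps state_t Let_def case_prod_conv power2_eq_square
    by (intro borel_measurable_Pair) measurable
qed simp

section \<open>Mean of the batch gradient and of the noise\<close>

lemma expectation_gradient_sample:
  assumes "i < b"
  shows "integrable M (\<lambda>\<omega>. gradient (f (B \<omega> t i)) x)"
    and "expectation (\<lambda>\<omega>. gradient (f (B \<omega> t i)) x) = gradient F x"
proof -
  have rv: "random_variable D (\<lambda>\<omega>. B \<omega> t i)" and D: "distr M D (\<lambda>\<omega>. B \<omega> t i) = D"
    using iid assms by (auto simp: iid_batches_def indep_vars_def2 dest!: bspec[where x = "(t, i)"])
  show "integrable M (\<lambda>\<omega>. gradient (f (B \<omega> t i)) x)"
    using integrable_gradient[of x] integrable_distr_eq[OF rv measurable_gradient_at[of x]] D by simp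
  show "expectation (\<lambda>\<omega>. gradient (f (B \<omega> t i)) x) = gradient F x"
    using integral_distr[OF rv measurable_gradient_at[of x]] D expected_gradient[of x] by simp
qed

lemma expectation_batch_grad:
  shows "integrable M (\<lambda>\<omega>. batch_grad f b (B \<omega> t) x)"
    and "expectation (\<lambda>\<omega>. batch_grad f b (B \<omega> t) x) = gradient F x"
proof -
  have int: "integrable M (\<lambda>\<omega>. \<Sum>i<b. gradient (f (B \<omega> t i)) x)"
    by (intro Bochner_Integration.integrable_sum expectation_gradient_sample) auto
  then show "integrable M (\<lambda>\<omega>. batch_grad f b (B \<omega> t) x)"
    unfolding batch_grad_def by (rule integrable_scaleR_right)
  have "expectation (\<lambda>\<omega>. \<Sum>i<b. gradient (f (B \<omega> t i)) x) = (\<Sum>i<b. gradient F x)"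
    by (subst Bochner_Integration.integral_sum)
      (simp_all add: expectation_gradient_sample del: sum_constant)
  then show "expectation (\<lambda>\<omega>. batch_grad f b (B \<omega> t) x) = gradient F x"
    unfolding batch_grad_def using int b_pos by (simp add: sum_constant_scaleR del: sum_constant)
qed

lemma norm_batch_grad_error_le:
  assumes "\<omega> \<in> space M"
  shows "norm (batch_grad f b (B \<omega> t) x - gradient F x) \<le> real CARD('n) * (2 * G)"
proof (rule norm_vec_le_componentwise)
  fix i
  have "\<bar>batch_grad f b (B \<omega> t) x $ i\<bar> \<le> G"
    by (rule batch_grad_component_bounded) (use assms sample_in_space in auto)
  then show "\<bar>(batch_grad f b (B \<omega> t) x - gradient F x) $ i\<bar> \<le> 2 * G"
    using expected_gradient_component_bounded[of x i] by simp
qed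

text \<open>For a deterministic state the linear term has mean 0, since the batch gradient is
  unbiased, and the quadratic term is controlled by the batch variance.\<close>

lemma expectation_noise_le:
  "expectation (\<lambda>\<omega>. noise p (batch_grad f b (B \<omega> t) (fst p))) \<le> 3 * L * \<gamma>\<^sup>2 / \<epsilon>\<^sup>2 * (\<sigma>\<^sup>2 / real b)"
proof -
  obtain x m v vhat where p: "p = (x, m, v, vhat)" by (metis prod_cases4)
  define u where "u = step_size vhat * gradient F (lookahead p)"
  define n where "n \<omega> = batch_grad f b (B \<omega> t) x - gradient F x" for \<omega>
  have n: "integrable M n" "expectation n = 0"
    using expectation_batch_grad[of t x] unfolding n_def by (auto simp: prob_space)
  have [measurable]: "n \<in> borel_measurable M" using n(1) by simp
  have n2: "integrable M (\<lambda>\<omega>. (norm (n \<omega>))\<^sup>2)"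
  proof (rule integrable_const_bound[OF AE_I2])
    show "norm ((norm (n \<omega>))\<^sup>2) \<le> (real CARD('n) * (2 * G))\<^sup>2" if "\<omega> \<in> space M" for \<omega>
      using norm_batch_grad_error_le[OF that, of t x] by (simp add: n_def power_mono)
  qed measurable
  have "expectation (\<lambda>\<omega>. noise p (batch_grad f b (B \<omega> t) (fst p)))
      = expectation (\<lambda>\<omega>. - \<gamma> * (u \<bullet> n \<omega>) + 3 * L * \<gamma>\<^sup>2 / \<epsilon>\<^sup>2 * (norm (n \<omega>))\<^sup>2)"
    by (simp add: noise_def p n_def u_def)
  also have "\<dots> = 3 * L * \<gamma>\<^sup>2 / \<epsilon>\<^sup>2 * expectation (\<lambda>\<omega>. (norm (n \<omega>))\<^sup>2)"
    using n n2 by simp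
  also have "\<dots> \<le> 3 * L * \<gamma>\<^sup>2 / \<epsilon>\<^sup>2 * (\<sigma>\<^sup>2 / real b)"
    using batch_variance[of t] L_pos unfolding bounded_batch_variance_def n_def
    by (intro mult_left_mono) auto
  finally show ?thesis .
qed

lemma measurable_noise:
  assumes P: "P \<in> borel_measurable N" and [measurable]: "Y \<in> borel_measurable N"
  shows "(\<lambda>\<omega>. noise (P \<omega>) (Y \<omega>)) \<in> borel_measurable N"
proof -
  define x where "x \<omega> = fst (P \<omega>)" for \<omega>
  define m where "m \<omega> = fst (snd (P \<omega>))" for \<omega>
  define v where "v \<omega> = fst (snd (snd (P \<omega>)))" for \<omega>
  define vhat where "vhat \<omega> = snd (snd (snd (P \<omega>)))" for \<omega>
  have P_eq: "P \<omega> = (x \<omega>, m \<omega>, v \<omega>, vhat \<omega>)" for \<omega>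
    by (simp add: x_def m_def v_def vhat_def)
  have [measurable]: "x \<in> borel_measurable N" "m \<in> borel_measurable N" "vhat \<in> borel_measurable N"
    unfolding x_def m_def vhat_def
    by (rule borel_measurable_continuous_on[OF _ P]; intro continuous_intros)+
  show ?thesis
    unfolding P_eq noise_def lookahead_def step_size_def prod.case by measurable
qed

text \<open>Only the finiteness of the bound matters: it provides the integrability required by
  Fubini and by the final averaging.\<close>

lemma noise_bounded:
  assumes \<omega>: "\<omega> \<in> space M"
  shows "\<bar>noise (state (B \<omega>) t) (batch_grad f b (B \<omega> t) (fst (state (B \<omega>) t)))\<bar>
    \<le> \<gamma> * ((real CARD('n) * (1 / \<epsilon> * G)) * (real CARD('n) * (2 * G)))
      + 3 * L * \<gamma>\<^sup>2 / \<epsilon>\<^sup>2 * (real CARD('n) * (2 * G))\<^sup>2"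
proof -
  obtain x m v vhat where S: "state (B \<omega>) t = (x, m, v, vhat)" by (metis prod_cases4)
  define n where "n = batch_grad f b (B \<omega> t) x - gradient F x"
  define u where "u = step_size vhat * gradient F (lookahead (x, m, v, vhat))"
  have "bounded_state (state (B \<omega>) t)"
    by (rule bounded_state) (use \<omega> sample_in_space in auto)
  then have "1 / G \<le> step_size vhat $ i" "step_size vhat $ i \<le> 1 / \<epsilon>" for i
    using step_size_bounds[OF \<epsilon>(1) G_pos, of vhat i] by (auto simp: S bounded_state_def)
  then have "\<bar>step_size vhat $ i\<bar> \<le> 1 / \<epsilon>" for i
    using G_pos by (smt (verit) divide_pos_pos)
  then have "norm u \<le> real CARD('n) * (1 / \<epsilon> * G)"
    unfolding u_def vector_mult_component abs_mult
    by (intro norm_vec_le_componentwise)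
      (auto simp only: vector_mult_component abs_mult intro!: mult_mono expected_gradient_component_bounded; use \<epsilon> in simp)
  moreover have n: "norm n \<le> real CARD('n) * (2 * G)"
    unfolding n_def by (rule norm_batch_grad_error_le[OF \<omega>])
  ultimately have "\<bar>u \<bullet> n\<bar> \<le> (real CARD('n) * (1 / \<epsilon> * G)) * (real CARD('n) * (2 * G))"
    using \<epsilon> G_pos by (intro order_trans[OF Cauchy_Schwarz_ineq2] mult_mono) auto
  then have "\<gamma> * \<bar>u \<bullet> n\<bar> \<le> \<gamma> * ((real CARD('n) * (1 / \<epsilon> * G)) * (real CARD('n) * (2 * G)))"
    using \<gamma> by (intro mult_left_mono) auto
  moreover have "3 * L * \<gamma>\<^sup>2 / \<epsilon>\<^sup>2 * (norm n)\<^sup>2 \<le> 3 * L * \<gamma>\<^sup>2 / \<epsilon>\<^sup>2 * (real CARD('n) * (2 * G))\<^sup>2"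
    using L_pos n by (intro mult_left_mono power_mono) auto
  moreover have "\<bar>- \<gamma> * (u \<bullet> n) + 3 * L * \<gamma>\<^sup>2 / \<epsilon>\<^sup>2 * (norm n)\<^sup>2\<bar>
      \<le> \<gamma> * \<bar>u \<bullet> n\<bar> + 3 * L * \<gamma>\<^sup>2 / \<epsilon>\<^sup>2 * (norm n)\<^sup>2"
    using L_pos \<gamma> by (intro order_trans[OF abs_triangle_ineq]) (simp add: abs_mult)
  ultimately show ?thesis
    by (simp add: S noise_def n_def[symmetric] u_def[symmetric])
qed

text \<open>The noise is a function of two independent blocks of samples, those before iteration
  \<open>t\<close> and those of iteration \<open>t\<close>. Freezing the first block reduces the
  claim to a deterministic state.\<close>

lemma expectation_state_noise_le:
  shows "integrable M (\<lambda>\<omega>. noise (state (B \<omega>) t) (batch_grad f b (B \<omega> t) (fst (state (B \<omega>) t))))"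
    and "expectation (\<lambda>\<omega>. noise (state (B \<omega>) t) (batch_grad f b (B \<omega> t) (fst (state (B \<omega>) t))))
      \<le> 3 * L * \<gamma>\<^sup>2 / \<epsilon>\<^sup>2 * (\<sigma>\<^sup>2 / real b)"
proof -
  let ?past = "{..<t} \<times> {..<b}" and ?now = "{t} \<times> {..<b}"
  let ?X = "\<lambda>\<omega>. restrict (\<lambda>(t, i). B \<omega> t i) ?past" and ?Y = "\<lambda>\<omega>. restrict (\<lambda>(t, i). B \<omega> t i) ?now"
  let ?S = "PiM ?past (\<lambda>_. D)" and ?N = "PiM ?now (\<lambda>_. D)"
  let ?state = "\<lambda>q. state (\<lambda>s i. q (s, i)) t" and ?bg = "\<lambda>y. batch_grad f b (\<lambda>i. y (t, i))"
  define h where "h = (\<lambda>(q, y). noise (?state q) (?bg y (fst (?state q))))"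
  have "indep_vars (\<lambda>_. D) (\<lambda>(t, i) \<omega>. B \<omega> t i) (UNIV \<times> {..<b})"
    using iid by (simp add: iid_batches_def)
  from indep_var_restrict[OF this, of ?past ?now]
  have ind: "indep_var ?S ?X ?N ?Y"
    by (auto simp: case_prod_beta')
  \<comment> \<open>Restriction changes the samples outside the block to an unspecified value, but
    the state at \<open>t\<close> never reads them.\<close>
  have state_eq: "?state (?X \<omega>) = state (B \<omega>) t" for \<omega>
    by (rule adasam_state_cong) simp
  have bg_eq: "?bg (?Y \<omega>) x = batch_grad f b (B \<omega> t) x" for \<omega> x
    by (rule batch_grad_cong) simp
  have h_eq: "h (?X \<omega>, ?Y \<omega>) = noise (state (B \<omega>) t) (batch_grad f b (B \<omega> t) (fst (state (B \<omega>) t)))" for \<omega>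
    unfolding h_def prod.case state_eq bg_eq ..
  have state_meas: "(\<lambda>p. ?state (fst p)) \<in> borel_measurable (?S \<Otimes>\<^sub>M ?N)"
  proof (rule measurable_state)
    fix s i assume "s < t" "i < b"
    then show "(\<lambda>p. fst p (s, i)) \<in> measurable (?S \<Otimes>\<^sub>M ?N) D"
      by (intro measurable_compose[OF measurable_fst measurable_component_singleton]) auto
  qed
  have h_meas: "h \<in> borel_measurable (?S \<Otimes>\<^sub>M ?N)"
    unfolding h_def case_prod_beta'
  proof (rule measurable_noise[OF state_meas], rule measurable_batch_grad)
    fix i assume "i < b"
    then show "(\<lambda>p. snd p (t, i)) \<in> measurable (?S \<Otimes>\<^sub>M ?N) D"
      by (intro measurable_compose[OF measurable_snd measurable_component_singleton]) auto
  next
    show "(\<lambda>p. fst (?state (fst p))) \<in> borel_measurable (?S \<Otimes>\<^sub>M ?N)"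
      by (rule borel_measurable_continuous_on[OF _ state_meas]) (intro continuous_intros)
  qed
  have XY: "(\<lambda>\<omega>. (?X \<omega>, ?Y \<omega>)) \<in> measurable M (?S \<Otimes>\<^sub>M ?N)"
    using indep_var_rv1[OF ind] indep_var_rv2[OF ind] by (rule measurable_Pair)
  show int: "integrable M (\<lambda>\<omega>. noise (state (B \<omega>) t) (batch_grad f b (B \<omega> t) (fst (state (B \<omega>) t))))"
    using noise_bounded[of _ t] measurable_compose[OF XY h_meas]
    by (intro integrable_const_bound[OF AE_I2]) (auto simp: h_eq)
  have "expectation (\<lambda>\<omega>. h (?X \<omega>, ?Y \<omega>)) \<le> 3 * L * \<gamma>\<^sup>2 / \<epsilon>\<^sup>2 * (\<sigma>\<^sup>2 / real b)"
  proof (rule indep_var_expectation_le[OF ind h_meas])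
    show "integrable M (\<lambda>\<omega>. h (?X \<omega>, ?Y \<omega>))"
      unfolding h_eq by (rule int)
    show "expectation (\<lambda>\<omega>. h (q, ?Y \<omega>)) \<le> 3 * L * \<gamma>\<^sup>2 / \<epsilon>\<^sup>2 * (\<sigma>\<^sup>2 / real b)" for q
      unfolding h_def prod.case bg_eq by (rule expectation_noise_le)
  qed
  then show "expectation (\<lambda>\<omega>. noise (state (B \<omega>) t) (batch_grad f b (B \<omega> t) (fst (state (B \<omega>) t))))
      \<le> 3 * L * \<gamma>\<^sup>2 / \<epsilon>\<^sup>2 * (\<sigma>\<^sup>2 / real b)"
    unfolding h_eq .
qed

lemma integrable_gradient_state:
  "integrable M (\<lambda>\<omega>. (norm (gradient F (fst (state (B \<omega>) t))))\<^sup>2)"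
proof (rule integrable_const_bound[OF AE_I2])
  show "norm ((norm (gradient F (fst (state (B \<omega>) t))))\<^sup>2) \<le> (real CARD('n) * G)\<^sup>2" for \<omega>
    using norm_vec_le_componentwise[OF expected_gradient_component_bounded] by (simp add: power_mono)
  have S: "(\<lambda>\<omega>. state (B \<omega>) t) \<in> borel_measurable M"
    using iid
    by (intro measurable_state) (auto simp: iid_batches_def indep_vars_def2 dest!: bspec)
  have [measurable]: "(\<lambda>\<omega>. fst (state (B \<omega>) t)) \<in> borel_measurable M"
    by (rule borel_measurable_continuous_on[OF _ S]) (intro continuous_intros)
  show "(\<lambda>\<omega>. (norm (gradient F (fst (state (B \<omega>) t))))\<^sup>2) \<in> borel_measurable M"
    by measurable
qed

text \<open>The decrease of the potential is telescoped for each outcome. The potential is then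
  bounded from both ends, so only gradient norms and noise remain when expectations are
  taken.\<close>

lemma sum_expected_gradient_le:
  assumes fstar: "\<And>y. fstar \<le> F y"
  defines "d \<equiv> real CARD('n)"
  shows "\<gamma> / (2 * G) * (\<Sum>t<T. expectation (\<lambda>\<omega>. (norm (gradient F (fst (state (B \<omega>) t))))\<^sup>2))
    \<le> (F x0 - fstar) + \<gamma> * G\<^sup>2 * (1 + \<kappa>) * (d * (1 / \<epsilon> - 1 / G))
      + L * \<gamma>\<^sup>2 * \<kappa>\<^sup>2 * G\<^sup>2 * (d * (1 / \<epsilon>\<^sup>2 - 1 / G\<^sup>2))
      + real T * (5 / 2 * \<gamma> / \<epsilon> * (L\<^sup>2 * (\<kappa>\<^sup>2 * \<gamma>\<^sup>2 * (d * (G\<^sup>2 / \<epsilon>\<^sup>2)))) + 43 / 16 * \<gamma> / \<epsilon> * (L\<^sup>2 * \<rho>\<^sup>2))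
      + real T * (3 * L * \<gamma>\<^sup>2 / \<epsilon>\<^sup>2 * (\<sigma>\<^sup>2 / real b))"
proof -
  define C where "C = 5 / 2 * \<gamma> / \<epsilon> * (L\<^sup>2 * (\<kappa>\<^sup>2 * \<gamma>\<^sup>2 * (d * (G\<^sup>2 / \<epsilon>\<^sup>2)))) + 43 / 16 * \<gamma> / \<epsilon> * (L\<^sup>2 * \<rho>\<^sup>2)"
  define K where "K = (F x0 - fstar) + \<gamma> * G\<^sup>2 * (1 + \<kappa>) * (d * (1 / \<epsilon> - 1 / G))
      + L * \<gamma>\<^sup>2 * \<kappa>\<^sup>2 * G\<^sup>2 * (d * (1 / \<epsilon>\<^sup>2 - 1 / G\<^sup>2))"
  define g where "g t \<omega> = (norm (gradient F (fst (state (B \<omega>) t))))\<^sup>2" for t \<omega>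
  define h where "h t \<omega> = noise (state (B \<omega>) t) (batch_grad f b (B \<omega> t) (fst (state (B \<omega>) t)))" for t \<omega>
  let ?cS = "\<gamma> * G\<^sup>2 * (1 + \<kappa>)" and ?cQ = "L * \<gamma>\<^sup>2 * \<kappa>\<^sup>2 * G\<^sup>2"
  have pointwise: "\<gamma> / (2 * G) * (\<Sum>t<T. g t \<omega>) \<le> K + real T * C + (\<Sum>t<T. h t \<omega>)" if \<omega>: "\<omega> \<in> space M" for \<omega>
  proof -
    have Y: "i < b \<Longrightarrow> B \<omega> t i \<in> space D" for t i
      using \<omega> by (rule sample_in_space)
    have "potential (state (B \<omega>) T) + \<gamma> / (2 * G) * (\<Sum>t<T. g t \<omega>)
        \<le> potential (state (B \<omega>) 0) + real T * C + (\<Sum>t<T. h t \<omega>)"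
    proof (induction T)
      case (Suc T)
      have "potential (state (B \<omega>) (Suc T)) \<le> potential (state (B \<omega>) T) - \<gamma> / (2 * G) * g T \<omega> + C + h T \<omega>"
        using potential_decrease[of "B \<omega>" T, OF Y] unfolding C_def g_def h_def d_def .
      moreover have "\<gamma> / (2 * G) * (\<Sum>t<Suc T. g t \<omega>) = \<gamma> / (2 * G) * (\<Sum>t<T. g t \<omega>) + \<gamma> / (2 * G) * g T \<omega>"
        by (simp only: sum.lessThan_Suc distrib_left)
      moreover have "real (Suc T) * C = real T * C + C" "(\<Sum>t<Suc T. h t \<omega>) = (\<Sum>t<T. h t \<omega>) + h T \<omega>"
        by (simp_all add: algebra_simps)
      ultimately show ?case using Suc by linarith
    qed simp
    \<comment> \<open>Initially the momentum is 0, so the shifted iterate is \<open>x0\<close>, and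
      every step size equals \<open>1 / \<epsilon>\<close>.\<close>
    moreover have "potential (state (B \<omega>) 0) = F x0 + ?cS * (d * (1 / \<epsilon>)) + ?cQ * (d * (1 / \<epsilon>\<^sup>2))"
      using \<epsilon> by (simp add: potential_def lookahead_def step_size_def d_def power_divide)
    \<comment> \<open>At the end every step size is still at least \<open>1 / G\<close>. Subtracting
      from the initial value yields the differences in \<open>1 / \<epsilon>\<close> and
      \<open>1 / G\<close> of the bound.\<close>
    moreover have "fstar + ?cS * (d * (1 / G)) + ?cQ * (d * (1 / G\<^sup>2)) \<le> potential (state (B \<omega>) T)"
    proof -
      obtain x m v vhat where S: "state (B \<omega>) T = (x, m, v, vhat)" by (metis prod_cases4)
      have "bounded_state (x, m, v, vhat)"
        using bounded_state[of "B \<omega>" T, OF Y] by (simp add: S)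
      then have \<eta>: "1 / G \<le> step_size vhat $ i" for i
        using step_size_bounds[OF \<epsilon>(1) G_pos, of vhat i] by (auto simp: bounded_state_def)
      have "(1 / G)\<^sup>2 \<le> (step_size vhat $ i)\<^sup>2" for i
        using \<eta>[of i] G_pos by (intro power_mono) auto
      then have "d * (1 / G) \<le> (\<Sum>i\<in>UNIV. step_size vhat $ i)" "d * (1 / G\<^sup>2) \<le> (\<Sum>i\<in>UNIV. (step_size vhat $ i)\<^sup>2)"
        using \<eta> sum_bounded_below[of UNIV "1 / G" "\<lambda>i. step_size vhat $ i"]
          sum_bounded_below[of UNIV "1 / G\<^sup>2" "\<lambda>i. (step_size vhat $ i)\<^sup>2"]
        by (auto simp: d_def power_divide)
      then show ?thesis
        unfolding S potential_def prod.case using fstar \<gamma> L_pos \<kappa>_nonneg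
        by (intro add_mono mult_left_mono) auto
    qed
    ultimately show ?thesis
      unfolding K_def right_diff_distrib by linarith
  qed
  have int_g: "integrable M (g t)" for t
    unfolding g_def by (rule integrable_gradient_state)
  have int_h: "integrable M (h t)" and h_le: "expectation (h t) \<le> 3 * L * \<gamma>\<^sup>2 / \<epsilon>\<^sup>2 * (\<sigma>\<^sup>2 / real b)" for t
    unfolding h_def by (rule expectation_state_noise_le)+
  have "\<gamma> / (2 * G) * (\<Sum>t<T. expectation (g t)) = expectation (\<lambda>\<omega>. \<gamma> / (2 * G) * (\<Sum>t<T. g t \<omega>))"
    using int_g by (simp add: integral_sum)
  also have "\<dots> \<le> expectation (\<lambda>\<omega>. K + real T * C + (\<Sum>t<T. h t \<omega>))"
    using int_g int_h pointwise by (intro integral_mono) auto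
  also have "\<dots> = K + real T * C + (\<Sum>t<T. expectation (h t))"
    using int_h by (simp add: integral_sum prob_space)
  also have "(\<Sum>t<T. expectation (h t)) \<le> real T * (3 * L * \<gamma>\<^sup>2 / \<epsilon>\<^sup>2 * (\<sigma>\<^sup>2 / real b))"
    using sum_bounded_above[of "{..<T}" "\<lambda>t. expectation (h t)", OF h_le] by simp
  finally show ?thesis
    unfolding g_def C_def K_def by simp
qed

end

section \<open>The averaged bound with its stated constants\<close>

theorem theorem1:
  fixes D :: "'a measure" and M :: "'w measure"
    and f :: "'a \<Rightarrow> real ^ 'n \<Rightarrow> real"
    and B :: "'w \<Rightarrow> nat \<Rightarrow> nat \<Rightarrow> 'a"
    and x0 :: "real ^ 'n"
    and L \<sigma> G \<gamma> \<rho> \<beta>1 \<beta>2 \<epsilon> fstar :: real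
    and b T :: nat
  defines "F \<equiv> expected_loss D f"
    and "x \<equiv> (\<lambda>\<omega>. adasam_iterate \<gamma> \<rho> \<beta>1 \<beta>2 \<epsilon> f b x0 (B \<omega>))"
    and "d \<equiv> real CARD('n)"
  assumes "prob_space D" and "prob_space M"
    and "\<And>y. integrable D (\<lambda>\<xi>. f \<xi> y)"
    and "\<And>\<xi> y. \<xi> \<in> space D \<Longrightarrow> f \<xi> differentiable (at y)"
    and "\<And>y. F differentiable (at y)"
    and "L > 0" and "smooth_losses L D f"
    and "bounded_variance \<sigma> D f"
    and "\<And>t. bounded_batch_variance \<sigma> M D f b (\<lambda>\<omega>. B \<omega> t)"
    and "bounded_gradients G D f"
    and "fstar \<in> range F" and "\<And>y. fstar \<le> F y"
    and "b \<ge> 1" and "iid_batches M D b B"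
    and "\<rho> \<ge> 0" and "0 \<le> \<beta>1" and "\<beta>1 < 1" and "0 \<le> \<beta>2" and "\<beta>2 \<le> 1"
    and "\<epsilon> > 0" and "\<epsilon> \<le> G"
    and "\<gamma> > 0" and "\<gamma> \<le> \<epsilon> / (16 * L)"
    and "T \<ge> 1"
  shows "(1 / real T) * (\<Sum>t<T. \<integral>\<omega>. (norm (gradient F (x \<omega> t)))\<^sup>2 \<partial>M)
    \<le> 2 * G * (F x0 - fstar) / (\<gamma> * real T)
      + (8 * G * \<gamma> * L / \<epsilon>) * (\<sigma>\<^sup>2 / (real b * \<epsilon>))
      + (45 * G * L\<^sup>2 * \<rho>\<^sup>2 / \<epsilon>
         + (2 * G ^ 3 / ((1 - \<beta>1) * real T)) * (d * (1 / \<epsilon> - 1 / G))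
         + (6 * \<gamma>\<^sup>2 * L\<^sup>2 * \<beta>1\<^sup>2 / (1 - \<beta>1)\<^sup>2) * (d * G ^ 3 / \<epsilon> ^ 3)
         + (2 * (4 + (\<beta>1 / (1 - \<beta>1))\<^sup>2) * \<gamma> * L * G ^ 3 / real T)
             * (d * (1 / \<epsilon>\<^sup>2 - 1 / G\<^sup>2))
         + (8 * G * \<gamma> * L / \<epsilon>) * (L * \<rho>\<^sup>2 / \<epsilon>))"
proof -
  interpret D: prob_space D by fact
  interpret M: prob_space M by fact
  interpret adasam D M f B x0 L \<sigma> G \<gamma> \<rho> \<beta>1 \<beta>2 \<epsilon> b
    using assms by unfold_locales (auto simp: F_def)
  define S where "S = (\<Sum>t<T. \<integral>\<omega>. (norm (gradient F (x \<omega> t)))\<^sup>2 \<partial>M)"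
  define X1 where "X1 = d * (1 / \<epsilon> - 1 / G)"
  define X2 where "X2 = d * (1 / \<epsilon>\<^sup>2 - 1 / G\<^sup>2)"
  have pos: "0 < G" "0 < real T" "0 < real b" "0 < 1 - \<beta>1" "0 \<le> d"
    using assms(3) \<open>T \<ge> 1\<close> b_pos G_pos \<beta>1 by auto
  have X2: "0 \<le> X2"
    unfolding X2_def using pos \<epsilon> by (intro mult_nonneg_nonneg) (auto simp: divide_simps power_mono)
  have "\<gamma> / (2 * G) * S \<le> (F x0 - fstar) + \<gamma> * G\<^sup>2 * (1 + \<kappa>) * X1
      + L * \<gamma>\<^sup>2 * \<kappa>\<^sup>2 * G\<^sup>2 * X2
      + real T * (5 / 2 * \<gamma> / \<epsilon> * (L\<^sup>2 * (\<kappa>\<^sup>2 * \<gamma>\<^sup>2 * (d * (G\<^sup>2 / \<epsilon>\<^sup>2)))) + 43 / 16 * \<gamma> / \<epsilon> * (L\<^sup>2 * \<rho>\<^sup>2))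
      + real T * (3 * L * \<gamma>\<^sup>2 / \<epsilon>\<^sup>2 * (\<sigma>\<^sup>2 / real b))" (is "_ \<le> ?R")
    unfolding S_def X1_def X2_def d_def x_def adasam_iterate_def F_def
    by (rule sum_expected_gradient_le) (use assms in \<open>auto simp: F_def\<close>)
  \<comment> \<open>This factor turns the weight \<open>\<gamma> / (2 * G)\<close> of the summed
    gradients into \<open>1 / T\<close>.\<close>
  then have "2 * G / (\<gamma> * real T) * (\<gamma> / (2 * G) * S) \<le> 2 * G / (\<gamma> * real T) * ?R"
    using pos \<gamma> by (intro mult_left_mono) auto
  moreover have "2 * G / (\<gamma> * real T) * (\<gamma> / (2 * G) * S) = (1 / real T) * S"
    using pos \<gamma> by simp
  moreover have "2 * G / (\<gamma> * real T) * ?R = 2 * G * (F x0 - fstar) / (\<gamma> * real T)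
      + 2 * G ^ 3 * (1 + \<kappa>) / real T * X1 + 2 * \<kappa>\<^sup>2 * \<gamma> * L * G ^ 3 / real T * X2
      + 5 * \<gamma>\<^sup>2 * L\<^sup>2 * \<kappa>\<^sup>2 * (d * G ^ 3 / \<epsilon> ^ 3) + 43 / 8 * (G * L\<^sup>2 * \<rho>\<^sup>2 / \<epsilon>)
      + 6 * (G * \<gamma> * L * \<sigma>\<^sup>2 / (\<epsilon>\<^sup>2 * real b))"
    (is "_ = _ + _ + ?t3 + ?t4 + ?t5 + ?t6")
  proof -
    \<comment> \<open>With \<open>k\<close> in place of \<kappa>, clearing denominators does not
      meet \<open>1 - \<beta>1\<close>.\<close>
    have "2 * G / (\<gamma> * real T) * ((F x0 - fstar) + \<gamma> * G\<^sup>2 * (1 + k) * X1 + L * \<gamma>\<^sup>2 * k\<^sup>2 * G\<^sup>2 * X2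
        + real T * (5 / 2 * \<gamma> / \<epsilon> * (L\<^sup>2 * (k\<^sup>2 * \<gamma>\<^sup>2 * (d * (G\<^sup>2 / \<epsilon>\<^sup>2)))) + 43 / 16 * \<gamma> / \<epsilon> * (L\<^sup>2 * \<rho>\<^sup>2))
        + real T * (3 * L * \<gamma>\<^sup>2 / \<epsilon>\<^sup>2 * (\<sigma>\<^sup>2 / real b)))
      = 2 * G * (F x0 - fstar) / (\<gamma> * real T)
        + 2 * G ^ 3 * (1 + k) / real T * X1 + 2 * k\<^sup>2 * \<gamma> * L * G ^ 3 / real T * X2
        + 5 * \<gamma>\<^sup>2 * L\<^sup>2 * k\<^sup>2 * (d * G ^ 3 / \<epsilon> ^ 3) + 43 / 8 * (G * L\<^sup>2 * \<rho>\<^sup>2 / \<epsilon>)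
        + 6 * (G * \<gamma> * L * \<sigma>\<^sup>2 / (\<epsilon>\<^sup>2 * real b))" for k
      using pos \<gamma>(1) \<epsilon>(1) by (simp add: divide_simps) (simp add: algebra_simps eval_nat_numeral)
    then show ?thesis .
  qed
  moreover have "2 * G ^ 3 * (1 + \<kappa>) / real T * X1 = 2 * G ^ 3 / ((1 - \<beta>1) * real T) * X1"
    using pos by (simp add: field_simps)
  \<comment> \<open>From here each term is compared with its counterpart in the claim: the square of
    \<kappa> with that square plus 4, then 5 with 6, \<open>43 / 8\<close> with 45, and 6 with
    8.\<close>
  moreover have "?t3 \<le> 2 * (4 + \<kappa>\<^sup>2) * \<gamma> * L * G ^ 3 / real T * X2"
    using pos \<gamma> L_pos X2 by (intro mult_right_mono divide_right_mono) auto
  moreover have "?t4 \<le> 6 * \<gamma>\<^sup>2 * L\<^sup>2 * \<beta>1\<^sup>2 / (1 - \<beta>1)\<^sup>2 * (d * G ^ 3 / \<epsilon> ^ 3)"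
  proof -
    have "?t4 \<le> 6 * \<gamma>\<^sup>2 * L\<^sup>2 * \<kappa>\<^sup>2 * (d * G ^ 3 / \<epsilon> ^ 3)"
      using pos \<epsilon> by (intro mult_right_mono) auto
    then show ?thesis by (simp add: power_divide)
  qed
  moreover have "?t5 \<le> 45 * G * L\<^sup>2 * \<rho>\<^sup>2 / \<epsilon>"
  proof -
    have "0 \<le> G * L\<^sup>2 * \<rho>\<^sup>2 / \<epsilon>" using pos \<epsilon> by simp
    then have "?t5 \<le> 45 * (G * L\<^sup>2 * \<rho>\<^sup>2 / \<epsilon>)" by (rule mult_right_mono[rotated]) simp
    then show ?thesis by simp
  qed
  moreover have "?t6 \<le> 8 * G * \<gamma> * L / \<epsilon> * (\<sigma>\<^sup>2 / (real b * \<epsilon>))"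
  proof -
    have "0 \<le> G * \<gamma> * L * \<sigma>\<^sup>2 / (\<epsilon>\<^sup>2 * real b)" using pos \<epsilon> \<gamma> L_pos by simp
    then have "?t6 \<le> 8 * (G * \<gamma> * L * \<sigma>\<^sup>2 / (\<epsilon>\<^sup>2 * real b))" by (rule mult_right_mono[rotated]) simp
    then show ?thesis by (simp add: power2_eq_square mult_ac)
  qed
  moreover have "0 \<le> 8 * G * \<gamma> * L / \<epsilon> * (L * \<rho>\<^sup>2 / \<epsilon>)"
    using pos \<epsilon> \<gamma> L_pos by simp
  ultimately show ?thesis
    unfolding S_def[symmetric] X1_def[symmetric] X2_def[symmetric] by linarith
qed

end
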